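(* Let $\mathcal X$ be a connected $C^1$-Banach manifold with the Hausdorff property, and let $T\mathcal X$ be equipped with a continuous norm. Then $$d(x,y):=\inf\Big\{\int_a^b\|\alpha'(t)\|_{\alpha(t)}\,dt\ \Big|\ \alpha:[a,b]\to\mathcal X\text{ piecewise }C^1\text{-curve with }\alpha(a)=x,\ \alpha(b)=y\Big\}$$ defines a metric on $\mathcal X$. Moreover, the topology induced by $d$ coincides with the topology on $\mathcal X$ induced by the atlas.
   Context: $\mathcal X$ is modelled on a real Banach space $\mathbb X$. A function $f:T\mathcal X\to\mathbb R$ is fibrewise uniformly continuous around $D\subset T_x\mathcal X$ if in any local trivialization $\tau$ of $T\mathcal X$ (e.g. the natural one induced by a chart), with $f_\tau:=f\circ\tau^{-1}$: for all $\varepsilon>0$ there exist a neighborhood $U$ of $x$ and $\delta>0$ such that $|f_\tau(x,v)-f_\tau(\hat x,\hat v)|<\varepsilon$ for all $(x,v)\in\tau(D)$, all $\hat x\in U$ and all $\hat v\in\mathbb X$ with $\|\hat v-v\|_{\mathbb X}<\delta$. A continuous norm on $T\mathcal X$ is a function $\|\cdot\|:T\mathcal X\to[0,\infty)$ such that for each $x\in\mathcal X$ the restriction $\|\cdot\|_x$ to $T_x\mathcal X$ is a norm equivalent to the norm of the model space $\mathbb X$, and $\|\cdot\|$ is fibrewise uniformly continuous around the unit sphere $\{v\in T_x\mathcal X:\|v\|_x=1\}$. *)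

theory Defs
  imports "HOL-Analysis.Analysis"
begin

text \<open>
  A chart is a pair of its domain and a map whose values matter only on that domain. The
  underlying set of the manifold is the union of the chart domains, and it carries no topology
  other than the one induced by the atlas.
\<close>

type_synonym ('m, 'b) chart = "'m set \<times> ('m \<Rightarrow> 'b)"

definition points :: "('m, 'b) chart set \<Rightarrow> 'm set" where
  "points A = \<Union> (fst ` A)"

definition transition :: "('m, 'b) chart \<Rightarrow> ('m, 'b) chart \<Rightarrow> 'b \<Rightarrow> 'b" where
  "transition c c' = snd c' \<circ> inv_into (fst c) (snd c)"

definition C1_on :: "'b set \<Rightarrow> ('b::real_normed_vector \<Rightarrow> 'b) \<Rightarrow> bool" where
  "C1_on S f \<longleftrightarrow> (\<exists>D :: 'b \<Rightarrow> 'b \<Rightarrow>\<^sub>L 'b.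
      (\<forall>z\<in>S. (f has_derivative blinfun_apply (D z)) (at z)) \<and> continuous_on S D)"

definition C1_atlas :: "('m, 'b::banach) chart set \<Rightarrow> bool" where
  "C1_atlas A \<longleftrightarrow>
     (\<forall>(U, \<phi>)\<in>A. inj_on \<phi> U \<and> open (\<phi> ` U)) \<and>
     (\<forall>c\<in>A. \<forall>c'\<in>A. open (snd c ` (fst c \<inter> fst c')) \<and>
        C1_on (snd c ` (fst c \<inter> fst c')) (transition c c'))"

definition atlas_topology :: "('m, 'b::banach) chart set \<Rightarrow> 'm topology" where
  "atlas_topology A =
     topology (\<lambda>W. W \<subseteq> points A \<and> (\<forall>(U, \<phi>)\<in>A. open (\<phi> ` (W \<inter> U))))"

lemma openin_atlas_topology:
  assumes "C1_atlas A"
  shows "openin (atlas_topology A) W \<longleftrightarrow>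
           W \<subseteq> points A \<and> (\<forall>(U, \<phi>)\<in>A. open (\<phi> ` (W \<inter> U)))"
proof -
  have "istopology (\<lambda>W. W \<subseteq> points A \<and> (\<forall>(U, \<phi>)\<in>A. open (\<phi> ` (W \<inter> U))))"
    unfolding istopology_def
  proof (intro conjI allI impI)
    fix S T
    assume S: "S \<subseteq> points A \<and> (\<forall>(U, \<phi>)\<in>A. open (\<phi> ` (S \<inter> U)))"
      and T: "T \<subseteq> points A \<and> (\<forall>(U, \<phi>)\<in>A. open (\<phi> ` (T \<inter> U)))"
    show "S \<inter> T \<subseteq> points A" using S by blast
    show "\<forall>(U, \<phi>)\<in>A. open (\<phi> ` (S \<inter> T \<inter> U))"
    proof clarify
      fix U \<phi> assume c: "(U, \<phi>) \<in> A"
      then have "inj_on \<phi> U" using assms by (auto simp: C1_atlas_def)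
      then have "\<phi> ` (S \<inter> T \<inter> U) = \<phi> ` (S \<inter> U) \<inter> \<phi> ` (T \<inter> U)"
        by (auto simp: inj_on_def)
      then show "open (\<phi> ` (S \<inter> T \<inter> U))" using S T c by auto
    qed
  next
    fix \<K> assume K: "\<forall>K\<in>\<K>. K \<subseteq> points A \<and> (\<forall>(U, \<phi>)\<in>A. open (\<phi> ` (K \<inter> U)))"
    show "\<Union> \<K> \<subseteq> points A" using K by blast
    show "\<forall>(U, \<phi>)\<in>A. open (\<phi> ` (\<Union> \<K> \<inter> U))"
    proof clarify
      fix U \<phi> assume c: "(U, \<phi>) \<in> A"
      have "\<phi> ` (\<Union> \<K> \<inter> U) = (\<Union>K\<in>\<K>. \<phi> ` (K \<inter> U))" by auto
      then show "open (\<phi> ` (\<Union> \<K> \<inter> U))" using K c by (auto intro!: open_UN)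
    qed
  qed
  then show ?thesis by (simp add: atlas_topology_def topology_inverse')
qed

lemma topspace_atlas_topology: "C1_atlas A \<Longrightarrow> topspace (atlas_topology A) = points A"
proof -
  assume A: "C1_atlas A"
  have "openin (atlas_topology A) (points A)"
    unfolding openin_atlas_topology[OF A]
  proof (intro conjI subset_refl ballI, clarify)
    fix U \<phi> assume c: "(U, \<phi>) \<in> A"
    then have "points A \<inter> U = U" by (force simp: points_def)
    then show "open (\<phi> ` (points A \<inter> U))" using A c by (auto simp: C1_atlas_def)
  qed
  moreover have "topspace (atlas_topology A) \<subseteq> points A"
    using openin_topspace[of "atlas_topology A"] unfolding openin_atlas_topology[OF A] by blast
  ultimately show ?thesis using openin_subset by blast
qed

text \<open>
  A tangent vector at \<open>x\<close> is an equivalence class of triples \<open>(c, x, v)\<close> with \<open>c\<close> a chart around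
  \<open>x\<close> and \<open>v\<close> in the model space, where \<open>(c, x, v)\<close> and \<open>(c', x, w)\<close> are equivalent iff the
  derivative at \<open>x\<close> of the change of charts from \<open>c\<close> to \<open>c'\<close> maps \<open>v\<close> to \<open>w\<close>. Hence a class has
  exactly one representative in each chart around its foot point, and the vector space operations
  may be carried out on representatives in the same chart.
\<close>

type_synonym ('m, 'b) tangent = "(('m, 'b) chart \<times> 'm \<times> 'b) set"

definition tangent_vector ::
  "('m, 'b::banach) chart set \<Rightarrow> ('m, 'b) chart \<Rightarrow> 'm \<Rightarrow> 'b \<Rightarrow> ('m, 'b) tangent" where
  "tangent_vector A c x v =
     {(c', x, frechet_derivative (transition c c') (at (snd c x)) v) | c'. c' \<in> A \<and> x \<in> fst c'}"

definition tangent_space :: "('m, 'b::banach) chart set \<Rightarrow> 'm \<Rightarrow> ('m, 'b) tangent set" where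
  "tangent_space A x = {tangent_vector A c x v | c v. c \<in> A \<and> x \<in> fst c}"

definition tangent_zero :: "('m, 'b::banach) chart set \<Rightarrow> 'm \<Rightarrow> ('m, 'b) tangent" where
  "tangent_zero A x = {(c, x, 0) | c. c \<in> A \<and> x \<in> fst c}"

definition tangent_add ::
  "('m, 'b::banach) tangent \<Rightarrow> ('m, 'b) tangent \<Rightarrow> ('m, 'b) tangent" where
  "tangent_add p q = {(c, x, v + w) | c x v w. (c, x, v) \<in> p \<and> (c, x, w) \<in> q}"

definition tangent_scale :: "real \<Rightarrow> ('m, 'b::banach) tangent \<Rightarrow> ('m, 'b) tangent" where
  "tangent_scale r p = {(c, x, r *\<^sub>R v) | c x v. (c, x, v) \<in> p}"

text \<open>The part of the tangent bundle lying over \<open>U\<close>.\<close>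

definition tangent_bundle_over ::
  "('m, 'b::banach) chart set \<Rightarrow> 'm set \<Rightarrow> ('m, 'b) tangent set" where
  "tangent_bundle_over A U = (\<Union>x\<in>U. tangent_space A x)"

text \<open>
  Local trivializations of the tangent bundle as a continuous Banach vector bundle: relative to
  every chart, \<open>\<tau>\<close> is over each point a toplinear automorphism \<open>G x\<close> of the model space (with
  inverse \<open>H x\<close>) that depends continuously on the point in the operator norm. In infinite
  dimensions this is stronger than \<open>\<tau>\<close> being a fibrewise linear homeomorphism. As the chart
  domains cover \<open>U\<close>, it makes \<open>\<tau>\<close> a fibre-preserving, fibrewise linear bijection from the bundle
  over \<open>U\<close> onto \<open>U \<times> UNIV\<close>.
\<close>

definition local_trivialization ::
  "('m, 'b::banach) chart set \<Rightarrow> 'm set \<Rightarrow> (('m, 'b) tangent \<Rightarrow> 'm \<times> 'b) \<Rightarrow> bool" where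
  "local_trivialization A U \<tau> \<longleftrightarrow>
     openin (atlas_topology A) U \<and>
     (\<forall>c\<in>A. \<exists>G H :: 'm \<Rightarrow> 'b \<Rightarrow>\<^sub>L 'b.
        continuous_map (subtopology (atlas_topology A) (U \<inter> fst c)) euclidean G \<and>
        continuous_map (subtopology (atlas_topology A) (U \<inter> fst c)) euclidean H \<and>
        (\<forall>x\<in>U \<inter> fst c. G x o\<^sub>L H x = id_blinfun \<and> H x o\<^sub>L G x = id_blinfun \<and>
           (\<forall>v. \<tau> (tangent_vector A c x v) = (x, G x v))))"

definition fibrewise_uniformly_continuous_around ::
  "('m, 'b::banach) chart set \<Rightarrow> (('m, 'b) tangent \<Rightarrow> real) \<Rightarrow> 'm \<Rightarrow> ('m, 'b) tangent set \<Rightarrow> bool"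
  where
  "fibrewise_uniformly_continuous_around A f x D \<longleftrightarrow>
     (\<forall>W \<tau>. local_trivialization A W \<tau> \<and> x \<in> W \<longrightarrow>
        (let f\<^sub>\<tau> = f \<circ> inv_into (tangent_bundle_over A W) \<tau> in
         \<forall>\<epsilon>>0. \<exists>U. openin (atlas_topology A) U \<and> x \<in> U \<and> U \<subseteq> W \<and>
           (\<exists>\<delta>>0. \<forall>v. (x, v) \<in> \<tau> ` D \<longrightarrow>
              (\<forall>x'\<in>U. \<forall>v'. norm (v' - v) < \<delta> \<longrightarrow> \<bar>f\<^sub>\<tau> (x, v) - f\<^sub>\<tau> (x', v')\<bar> < \<epsilon>))))"

definition continuous_norm ::
  "('m, 'b::banach) chart set \<Rightarrow> (('m, 'b) tangent \<Rightarrow> real) \<Rightarrow> bool" where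
  "continuous_norm A nrm \<longleftrightarrow>
     (\<forall>x\<in>points A.
        (\<forall>p\<in>tangent_space A x. 0 \<le> nrm p \<and> (nrm p = 0 \<longleftrightarrow> p = tangent_zero A x)) \<and>
        (\<forall>p\<in>tangent_space A x. \<forall>r. nrm (tangent_scale r p) = \<bar>r\<bar> * nrm p) \<and>
        (\<forall>p\<in>tangent_space A x. \<forall>q\<in>tangent_space A x. nrm (tangent_add p q) \<le> nrm p + nrm q) \<and>
        (\<forall>c\<in>A. x \<in> fst c \<longrightarrow> (\<exists>m M. 0 < m \<and> 0 < M \<and>
           (\<forall>v. m * norm v \<le> nrm (tangent_vector A c x v) \<and>
                nrm (tangent_vector A c x v) \<le> M * norm v))) \<and>
        fibrewise_uniformly_continuous_around A nrm x {p \<in> tangent_space A x. nrm p = 1})"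

definition C1_curve_on ::
  "('m, 'b::banach) chart set \<Rightarrow> real \<Rightarrow> real \<Rightarrow> (real \<Rightarrow> 'm) \<Rightarrow> bool" where
  "C1_curve_on A a b \<alpha> \<longleftrightarrow>
     continuous_map (top_of_set {a..b}) (atlas_topology A) \<alpha> \<and>
     (\<forall>(U, \<phi>)\<in>A. \<exists>\<alpha>'.
        (\<forall>t\<in>{a..b} \<inter> \<alpha> -` U. (\<phi> \<circ> \<alpha> has_vector_derivative \<alpha>' t) (at t within {a..b})) \<and>
        continuous_on ({a..b} \<inter> \<alpha> -` U) \<alpha>')"

text \<open>
  The pieces are closed intervals, so one-sided derivatives exist at the break points and \<open>\<alpha>\<close> is
  continuous on all of \<open>{a..b}\<close>. The library's \<open>piecewise_C1_differentiable_on\<close>, besides being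
  about maps into normed spaces, would allow derivatives that blow up at break points.
\<close>

definition piecewise_C1_curve ::
  "('m, 'b::banach) chart set \<Rightarrow> real \<Rightarrow> real \<Rightarrow> (real \<Rightarrow> 'm) \<Rightarrow> bool" where
  "piecewise_C1_curve A a b \<alpha> \<longleftrightarrow> a < b \<and>
     (\<exists>n s. s 0 = a \<and> s n = b \<and>
        (\<forall>i<n. s i < s (Suc i) \<and> C1_curve_on A (s i) (s (Suc i)) \<alpha>))"

text \<open>
  The velocity is meaningful at interior points of the pieces, where it is the tangent vector at
  \<open>\<alpha> t\<close> whose representative in each chart is the derivative of the curve in that chart. The
  remaining finitely many parameters do not affect the integral below.
\<close>

definition velocity ::
  "('m, 'b::banach) chart set \<Rightarrow> (real \<Rightarrow> 'm) \<Rightarrow> real \<Rightarrow> ('m, 'b) tangent" where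
  "velocity A \<alpha> t =
     {(c, \<alpha> t, vector_derivative (snd c \<circ> \<alpha>) (at t)) | c. c \<in> A \<and> \<alpha> t \<in> fst c}"

definition curve_length ::
  "('m, 'b::banach) chart set \<Rightarrow> (('m, 'b) tangent \<Rightarrow> real) \<Rightarrow> real \<Rightarrow> real \<Rightarrow> (real \<Rightarrow> 'm) \<Rightarrow> real"
  where
  "curve_length A nrm a b \<alpha> = integral {a..b} (\<lambda>t. nrm (velocity A \<alpha> t))"

text \<open>
  The value 0 outside the manifold is only there because \<open>Metric_space\<close> asks for nonnegativity
  and symmetry on the whole type.
\<close>

definition path_distance ::
  "('m, 'b::banach) chart set \<Rightarrow> (('m, 'b) tangent \<Rightarrow> real) \<Rightarrow> 'm \<Rightarrow> 'm \<Rightarrow> real" where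
  "path_distance A nrm x y =
     (if x \<in> points A \<and> y \<in> points A
      then Inf {curve_length A nrm a b \<alpha> | a b \<alpha>. piecewise_C1_curve A a b \<alpha> \<and> \<alpha> a = x \<and> \<alpha> b = y}
      else 0)"

end

theory Submission
  imports Defs
begin

text \<open>
  By fibrewise uniform continuity around the unit sphere and homogeneity, the norms on the tangent
  spaces over a small chart ball around \<open>x\<close> are comparable to the norm of the model space with
  constants \<open>m\<close> and \<open>M\<close>. A straight segment in the chart then has length at most \<open>M\<close> times its
  chart length. Conversely, a curve from \<open>x\<close> of length less than \<open>m * r\<close> cannot leave the chart
  ball of radius \<open>r\<close>: up to a first exit time \<open>T\<close> its chart image moves by at most its length over
  \<open>m\<close>, so it converges inside the ball by completeness of the model space, and by the Hausdorff
  property the limit is the chart image of the curve at time \<open>T\<close>. Both estimates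
  together give definiteness of \<open>d\<close> and the equality of the topologies.
\<close>

subsection \<open>Charts and tangent vectors\<close>

text \<open>At the exit time it is not even known that the curve lies in the chart domain. On the
  line with two origins, a curve can run into the second origin while its image in a chart around
  the first one tends to the image of the first; the infimum of lengths between the two origins is
  then 0. So the limit must be constructed from the bound on the length before it can be identified
  with a point of the curve. Completeness stands in for compactness, since closed balls of the model
  space need not be compact. For the same reason, mere pointwise continuity of the norm would not
  give constants that serve all directions at once; uniformity over the unit sphere does. The only
  trivialization to which this uniformity is applied is the natural one of a chart. All estimates
  are made for single curves, whose two-sided derivatives may be missing at finitely many
  parameters. The infimum is taken last, and connectedness makes it an infimum over a nonempty
  set.\<close>

lemma open_image_atlas:
  assumes "C1_atlas A" "openin (atlas_topology A) W" "c \<in> A"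
  shows "open (snd c ` (W \<inter> fst c))"
  using assms by (auto simp: openin_atlas_topology split: prod.splits)

locale C1_manifold =
  fixes A :: "('m, 'b::banach) chart set"
  assumes atlas: "C1_atlas A"
begin

abbreviation "X \<equiv> atlas_topology A"

lemma chart_inj: "c \<in> A \<Longrightarrow> inj_on (snd c) (fst c)"
  and chart_open: "c \<in> A \<Longrightarrow> open (snd c ` fst c)"
  using atlas by (auto simp: C1_atlas_def)

lemma inter_open: "c \<in> A \<Longrightarrow> c' \<in> A \<Longrightarrow> open (snd c ` (fst c \<inter> fst c'))"
  using atlas by (auto simp: C1_atlas_def)

lemma atlas_C1_on:
  "c \<in> A \<Longrightarrow> c' \<in> A \<Longrightarrow> C1_on (snd c ` (fst c \<inter> fst c')) (transition c c')"
  using atlas unfolding C1_atlas_def by blast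

lemma mem_points_iff: "x \<in> points A \<longleftrightarrow> (\<exists>c\<in>A. x \<in> fst c)"
  by (auto simp: points_def)

lemma topspace_X [simp]: "topspace X = points A"
  by (rule topspace_atlas_topology[OF atlas])

lemma open_image_chart: "openin X W \<Longrightarrow> c \<in> A \<Longrightarrow> open (snd c ` (W \<inter> fst c))"
  using atlas by (rule open_image_atlas)

lemma transition_chart: "c \<in> A \<Longrightarrow> x \<in> fst c \<Longrightarrow> transition c c' (snd c x) = snd c' x"
  by (simp add: transition_def chart_inj)

text \<open>The derivative is bundled as a bounded operator and indexed by the point of the
  manifold, so that continuous dependence in the operator norm can be stated on the manifold itself.
  It is meaningful only for \<open>x\<close> in both chart domains.\<close>

definition Dtrans :: "('m, 'b) chart \<Rightarrow> ('m, 'b) chart \<Rightarrow> 'm \<Rightarrow> 'b \<Rightarrow>\<^sub>L 'b" where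
  "Dtrans c c' x = Blinfun (frechet_derivative (transition c c') (at (snd c x)))"

lemma
  assumes "c \<in> A" "c' \<in> A"
  shows has_derivative_transition: "\<And>x. x \<in> fst c \<Longrightarrow> x \<in> fst c' \<Longrightarrow>
      (transition c c' has_derivative blinfun_apply (Dtrans c c' x)) (at (snd c x))"
    and Dtrans_apply: "\<And>x v. x \<in> fst c \<Longrightarrow> x \<in> fst c' \<Longrightarrow>
      Dtrans c c' x v = frechet_derivative (transition c c') (at (snd c x)) v"
    and continuous_on_Dtrans:
      "continuous_on (snd c ` (fst c \<inter> fst c')) (Dtrans c c' \<circ> inv_into (fst c) (snd c))"
proof -
  let ?S = "snd c ` (fst c \<inter> fst c')"
  obtain D :: "'b \<Rightarrow> 'b \<Rightarrow>\<^sub>L 'b"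
    where D: "\<And>z. z \<in> ?S \<Longrightarrow> (transition c c' has_derivative blinfun_apply (D z)) (at z)"
      and cont: "continuous_on ?S D"
    using atlas_C1_on[OF assms] unfolding C1_on_def by blast
  \<comment> \<open>\<open>C1_on\<close> provides some derivative field \<open>D\<close>. Uniqueness
    of derivatives at points of an open set identifies it with \<open>Dtrans\<close>, which thereby
    inherits the continuity.\<close>
  have eq: "Dtrans c c' x = D (snd c x)"
    and fr: "frechet_derivative (transition c c') (at (snd c x)) = blinfun_apply (D (snd c x))"
    if "x \<in> fst c" "x \<in> fst c'" for x
  proof -
    have "(transition c c' has_derivative blinfun_apply (D (snd c x))) (at (snd c x))"
      using that by (intro D) auto
    from frechet_derivative_at[OF this]
    show "frechet_derivative (transition c c') (at (snd c x)) = blinfun_apply (D (snd c x))" by simp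
    then show "Dtrans c c' x = D (snd c x)"
      by (simp add: Dtrans_def blinfun_apply_inverse)
  qed
  show "(transition c c' has_derivative blinfun_apply (Dtrans c c' x)) (at (snd c x))"
    if "x \<in> fst c" "x \<in> fst c'" for x
    using that by (auto simp: eq intro!: D)
  show "Dtrans c c' x v = frechet_derivative (transition c c') (at (snd c x)) v"
    if "x \<in> fst c" "x \<in> fst c'" for x v
    using that by (simp add: eq fr)
  show "continuous_on ?S (Dtrans c c' \<circ> inv_into (fst c) (snd c))"
    by (rule continuous_on_eq[OF cont]) (use assms chart_inj in \<open>auto simp: eq\<close>)
qed

lemma isCont_transition:
  assumes "c \<in> A" "c' \<in> A" "x \<in> fst c" "x \<in> fst c'"
  shows "isCont (transition c c') (snd c x)"
  using has_derivative_transition[OF assms] has_derivative_continuous by blast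

text \<open>Chain rule: on the open image of the overlap of \<open>c\<close> and \<open>c'\<close>,
  the two changes of charts compose to the direct one. This cocycle identity makes the
  representatives of a tangent vector in different charts consistent.\<close>

lemma Dtrans_compose:
  assumes "c \<in> A" "c' \<in> A" "c'' \<in> A" "x \<in> fst c" "x \<in> fst c'" "x \<in> fst c''"
  shows "Dtrans c' c'' x (Dtrans c c' x v) = Dtrans c c'' x v"
proof -
  have "(transition c' c'' \<circ> transition c c' has_derivative
          blinfun_apply (Dtrans c' c'' x) \<circ> blinfun_apply (Dtrans c c' x)) (at (snd c x))"
    using assms
    by (intro diff_chain_at has_derivative_transition) (auto simp: transition_chart
        intro!: has_derivative_transition)
  then have "(transition c c'' has_derivative
          blinfun_apply (Dtrans c' c'' x) \<circ> blinfun_apply (Dtrans c c' x)) (at (snd c x))"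
    by (rule has_derivative_transform_within_open[OF _ inter_open[OF assms(1,2)]])
       (use assms in \<open>auto simp: transition_chart\<close>)
  from has_derivative_unique[OF this has_derivative_transition[of c c'']]
  show ?thesis using assms by (metis comp_apply)
qed

lemma Dtrans_id:
  assumes "c \<in> A" "x \<in> fst c"
  shows "Dtrans c c x v = v"
proof -
  have "(transition c c has_derivative id) (at (snd c x))"
    by (rule has_derivative_transform_within_open[OF has_derivative_id chart_open[OF assms(1)]])
       (use assms in \<open>auto simp: transition_chart id_def\<close>)
  from has_derivative_unique[OF this has_derivative_transition[of c c]]
  show ?thesis using assms by (metis id_apply)
qed

lemma tangent_vector_eq:
  assumes "c \<in> A" "x \<in> fst c"
  shows "tangent_vector A c x v = {(c', x, Dtrans c c' x v) | c'. c' \<in> A \<and> x \<in> fst c'}"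
  unfolding tangent_vector_def using assms by (auto simp: Dtrans_apply)

lemma tangent_vector_change:
  assumes "c \<in> A" "c' \<in> A" "x \<in> fst c" "x \<in> fst c'"
  shows "tangent_vector A c' x (Dtrans c c' x v) = tangent_vector A c x v"
  using assms by (auto simp: tangent_vector_eq Dtrans_compose)

lemma mem_tangent_vector:
  assumes "c \<in> A" "x \<in> fst c" "c' \<in> A" "x \<in> fst c'"
  shows "(c', y, w) \<in> tangent_vector A c x v \<longleftrightarrow> y = x \<and> w = Dtrans c c' x v"
  using assms by (simp add: tangent_vector_eq del: split_paired_Ex)

text \<open>Every class has a representative in any prescribed chart around its foot point, so
  arguments in a fibre may fix one chart.\<close>

lemma tangent_space_eq:
  assumes "c \<in> A" "x \<in> fst c"
  shows "tangent_space A x = range (tangent_vector A c x)"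
proof
  show "range (tangent_vector A c x) \<subseteq> tangent_space A x"
    using assms by (auto simp: tangent_space_def simp del: split_paired_Ex)
  show "tangent_space A x \<subseteq> range (tangent_vector A c x)"
  proof
    fix p assume "p \<in> tangent_space A x"
    then obtain c' v where "p = tangent_vector A c' x v" "c' \<in> A" "x \<in> fst c'"
      unfolding tangent_space_def by blast
    then have "p = tangent_vector A c x (Dtrans c' c x v)"
      using tangent_vector_change assms by simp
    then show "p \<in> range (tangent_vector A c x)" by blast
  qed
qed

lemma tangent_scale_vector:
  assumes "c \<in> A" "x \<in> fst c"
  shows "tangent_scale r (tangent_vector A c x v) = tangent_vector A c x (r *\<^sub>R v)"
proof -
  have "tangent_scale r (tangent_vector A c x v) =
      {(c', x, r *\<^sub>R Dtrans c c' x v) | c'. c' \<in> A \<and> x \<in> fst c'}"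
    unfolding tangent_scale_def tangent_vector_eq[OF assms] by blast
  then show ?thesis
    by (simp add: tangent_vector_eq[OF assms] blinfun.scaleR_right)
qed


section \<open>Charts as homeomorphisms and their natural trivializations\<close>

lemma openin_chart_preimage:
  assumes "c \<in> A" "open S"
  shows "openin X {x \<in> fst c. snd c x \<in> S}"
proof -
  let ?W = "{x \<in> fst c. snd c x \<in> S}"
  have "open (snd c' ` (?W \<inter> fst c'))" if c': "c' \<in> A" for c'
  proof -
    let ?T = "snd c' ` (fst c' \<inter> fst c)"
    \<comment> \<open>Seen in another chart, the set is a preimage of \<open>S\<close> under the
      change of charts, which is continuous because it is differentiable.\<close>
    have "snd c' ` (?W \<inter> fst c') = ?T \<inter> transition c' c -` S"
      using c' by (auto simp: transition_chart)
    moreover have "continuous_on ?T (transition c' c)"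
      using c' assms by (auto intro!: continuous_at_imp_continuous_on isCont_transition)
    ultimately show ?thesis
      using continuous_open_preimage[OF _ inter_open[OF c' assms(1)] assms(2)] by simp
  qed
  moreover have "?W \<subseteq> points A" using assms mem_points_iff by blast
  ultimately show ?thesis by (auto simp: openin_atlas_topology[OF atlas])
qed

lemma openin_chart_domain: "c \<in> A \<Longrightarrow> openin X (fst c)"
  using openin_chart_preimage[of c UNIV] by simp

text \<open>A chart is a homeomorphism onto its open image, phrased with filters. The clause on
  \<open>fst c\<close> cannot be dropped, because \<open>snd c\<close> takes arbitrary values off
  the chart domain.\<close>

lemma limitin_chart:
  assumes "c \<in> A" "x \<in> fst c"
  shows "limitin X f x F \<longleftrightarrow>
    (\<forall>\<^sub>F t in F. f t \<in> fst c) \<and> ((\<lambda>t. snd c (f t)) \<longlongrightarrow> snd c x) F" (is "?l \<longleftrightarrow> ?r")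
proof
  assume l: ?l
  have "\<forall>\<^sub>F t in F. snd c (f t) \<in> S" if "open S" "snd c x \<in> S" for S
  proof -
    have "\<forall>\<^sub>F t in F. f t \<in> {x \<in> fst c. snd c x \<in> S}"
      using l that assms openin_chart_preimage[OF assms(1) that(1)] unfolding limitin_def by blast
    then show ?thesis by eventually_elim auto
  qed
  moreover have "\<forall>\<^sub>F t in F. f t \<in> fst c"
    using l assms openin_chart_domain unfolding limitin_def by blast
  ultimately show ?r by (auto intro: topological_tendstoI)
next
  assume r: ?r
  have "\<forall>\<^sub>F t in F. f t \<in> W" if W: "openin X W" "x \<in> W" for W
  proof -
    have "\<forall>\<^sub>F t in F. snd c (f t) \<in> snd c ` (W \<inter> fst c)"
      using r W assms by (intro topological_tendstoD open_image_chart) auto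
    moreover have "\<forall>\<^sub>F t in F. f t \<in> fst c" using r by simp
    ultimately show ?thesis
      by eventually_elim (use chart_inj[OF assms(1)] in \<open>auto simp: inj_on_def\<close>)
  qed
  then show ?l using assms mem_points_iff by (auto simp: limitin_def)
qed

lemma continuous_map_Dtrans:
  assumes "c \<in> A" "c' \<in> A"
  shows "continuous_map (subtopology X (fst c \<inter> fst c')) euclidean (Dtrans c c')"
proof -
  let ?g = "Dtrans c c' \<circ> inv_into (fst c) (snd c)" and ?S = "snd c ` (fst c \<inter> fst c')"
  have "openin (subtopology X (fst c \<inter> fst c')) {x \<in> fst c \<inter> fst c'. Dtrans c c' x \<in> T}"
    if "open T" for T
  proof -
    have "open (?S \<inter> ?g -` T)"
      using continuous_open_preimage[OF continuous_on_Dtrans inter_open] assms that by simp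
    then have "openin X {x \<in> fst c. snd c x \<in> ?S \<inter> ?g -` T}"
      by (rule openin_chart_preimage[OF assms(1)])
    moreover have "snd c x \<in> ?S \<longleftrightarrow> x \<in> fst c'" if "x \<in> fst c" for x
      using inj_on_image_mem_iff[OF chart_inj[OF assms(1)] that, of "fst c \<inter> fst c'"] that by auto
    then have "{x \<in> fst c. snd c x \<in> ?S \<inter> ?g -` T} = {x \<in> fst c \<inter> fst c'. Dtrans c c' x \<in> T}"
      by (auto simp: chart_inj[OF assms(1)] inj_on_eq_iff[OF chart_inj[OF assms(1)]])
    ultimately show ?thesis by (auto simp: openin_subtopology)
  qed
  moreover have "topspace (subtopology X (fst c \<inter> fst c')) = fst c \<inter> fst c'"
    using assms mem_points_iff by auto
  ultimately show ?thesis by (auto simp: continuous_map_def)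
qed

text \<open>The trivialization induced by \<open>c\<close>. A tangent vector over
  \<open>fst c\<close> contains exactly one triple with first component \<open>c\<close>; the
  remaining pair is its foot point together with its coordinate vector.\<close>

definition chart_triv :: "('m, 'b) chart \<Rightarrow> ('m, 'b) tangent \<Rightarrow> 'm \<times> 'b" where
  "chart_triv c p = (THE q. (c, q) \<in> p)"

lemma chart_triv_tangent_vector:
  assumes "c \<in> A" "x \<in> fst c" "c' \<in> A" "x \<in> fst c'"
  shows "chart_triv c (tangent_vector A c' x v) = (x, Dtrans c' c x v)"
  unfolding chart_triv_def
  by (rule the_equality) (use assms in \<open>auto simp: mem_tangent_vector split: prod.splits\<close>)

text \<open>Relative to a chart \<open>c'\<close>, the fibre automorphism is the derivative of the
  change from \<open>c'\<close> to \<open>c\<close>, and its inverse is the derivative of the change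
  back. This gives access to the uniform continuity of the norm in chart coordinates.\<close>

lemma local_trivialization_chart:
  assumes "c \<in> A"
  shows "local_trivialization A (fst c) (chart_triv c)"
  unfolding local_trivialization_def
proof (intro conjI ballI openin_chart_domain assms exI)
  fix c' assume c': "c' \<in> A"
  show "continuous_map (subtopology X (fst c \<inter> fst c')) euclidean (Dtrans c' c)"
    using continuous_map_Dtrans[OF c' assms] by (simp add: Int_commute)
  show "continuous_map (subtopology X (fst c \<inter> fst c')) euclidean (Dtrans c c')"
    by (rule continuous_map_Dtrans[OF assms c'])
  fix x assume x: "x \<in> fst c \<inter> fst c'"
  show "Dtrans c' c x o\<^sub>L Dtrans c c' x = id_blinfun" "Dtrans c c' x o\<^sub>L Dtrans c' c x = id_blinfun"
    using x c' assms by (auto intro!: blinfun_eqI simp: Dtrans_compose Dtrans_id)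
  show "\<forall>v. chart_triv c (tangent_vector A c' x v) = (x, Dtrans c' c x v)"
    using x c' assms by (simp add: chart_triv_tangent_vector)
qed

lemma inv_chart_triv:
  assumes "c \<in> A" "x \<in> fst c"
  shows "inv_into (tangent_bundle_over A (fst c)) (chart_triv c) (x, v) = tangent_vector A c x v"
proof (rule inv_into_f_eq)
  have repr: "\<exists>y w. p = tangent_vector A c y w \<and> y \<in> fst c"
    if "p \<in> tangent_bundle_over A (fst c)" for p
    using that tangent_space_eq[OF assms(1)] unfolding tangent_bundle_over_def by blast
  show "inj_on (chart_triv c) (tangent_bundle_over A (fst c))"
  proof (rule inj_onI)
    fix p q assume "p \<in> tangent_bundle_over A (fst c)" "q \<in> tangent_bundle_over A (fst c)"
      and eq: "chart_triv c p = chart_triv c q"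
    then obtain y w y' w' where "p = tangent_vector A c y w" "y \<in> fst c"
      "q = tangent_vector A c y' w'" "y' \<in> fst c" using repr by blast
    with eq assms(1) show "p = q" by (simp add: chart_triv_tangent_vector Dtrans_id)
  qed
  show "tangent_vector A c x v \<in> tangent_bundle_over A (fst c)"
    using assms tangent_space_eq[OF assms] unfolding tangent_bundle_over_def by blast
  show "chart_triv c (tangent_vector A c x v) = (x, v)"
    using assms by (simp add: chart_triv_tangent_vector Dtrans_id)
qed

subsection \<open>Curves in a manifold\<close>

lemma limitin_continuous_map_within:
  assumes "continuous_map (top_of_set T) X \<alpha>" "t \<in> T"
  shows "limitin X \<alpha> (\<alpha> t) (at t within T)"
  unfolding limitin_def
proof (intro conjI allI impI)
  show "\<alpha> t \<in> topspace X" using assms continuous_map_image_subset_topspace by fastforce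
  fix W assume W: "openin X W \<and> \<alpha> t \<in> W"
  then have "openin (top_of_set T) {s \<in> T. \<alpha> s \<in> W}"
    using openin_continuous_map_preimage[OF assms(1)] by simp
  then obtain U where U: "open U" "{s \<in> T. \<alpha> s \<in> W} = T \<inter> U" by (auto simp: openin_open)
  then have "t \<in> U" using W assms by blast
  with U show "\<forall>\<^sub>F s in at t within T. \<alpha> s \<in> W"
    unfolding eventually_at_topological by blast
qed

lemma eventually_in_chart:
  assumes "continuous_map (top_of_set T) X \<alpha>" "t \<in> T" "c \<in> A" "\<alpha> t \<in> fst c"
  shows "\<forall>\<^sub>F s in at t within T. \<alpha> s \<in> fst c"
  using limitin_continuous_map_within[OF assms(1,2)] openin_chart_domain[OF assms(3)] assms(4)
  by (auto simp: limitin_def)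

lemma eventually_in_chart_interior:
  fixes \<alpha> :: "real \<Rightarrow> 'm"
  assumes "continuous_map (top_of_set {a..b}) X \<alpha>" "t \<in> {a<..<b}" "c \<in> A" "\<alpha> t \<in> fst c"
  shows "\<forall>\<^sub>F s in at t. \<alpha> s \<in> fst c"
  using eventually_in_chart[OF assms(1) _ assms(3,4)] assms(2)
  by (simp add: at_within_Icc_at[of a t b])

text \<open>Chain rule. The eventuality \<open>ev\<close> is needed because the change of charts
  maps one coordinate curve to the other only while the curve is in \<open>fst c\<close>.\<close>

lemma has_vector_derivative_change_chart:
  assumes "c \<in> A" "c' \<in> A" "\<alpha> t \<in> fst c" "\<alpha> t \<in> fst c'" "t \<in> T"
    and ev: "\<forall>\<^sub>F s in at t within T. \<alpha> s \<in> fst c"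
    and d: "(snd c \<circ> \<alpha> has_vector_derivative w) (at t within T)"
  shows "(snd c' \<circ> \<alpha> has_vector_derivative Dtrans c c' (\<alpha> t) w) (at t within T)"
proof -
  have "(transition c c' \<circ> (snd c \<circ> \<alpha>) has_derivative
      blinfun_apply (Dtrans c c' (\<alpha> t)) \<circ> (\<lambda>r. r *\<^sub>R w)) (at t within T)"
    using d has_derivative_at_withinI[OF has_derivative_transition[OF assms(1-4)]]
    unfolding has_vector_derivative_def by (intro diff_chain_within) auto
  moreover have "\<forall>\<^sub>F s in at t within T. (transition c c' \<circ> (snd c \<circ> \<alpha>)) s = (snd c' \<circ> \<alpha>) s"
    using ev by eventually_elim (use assms in \<open>simp add: transition_chart\<close>)
  ultimately have "(snd c' \<circ> \<alpha> has_derivative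
      blinfun_apply (Dtrans c c' (\<alpha> t)) \<circ> (\<lambda>r. r *\<^sub>R w)) (at t within T)"
    by (rule has_derivative_transform_eventually) (use assms in \<open>simp_all add: transition_chart\<close>)
  then show ?thesis
    by (simp add: has_vector_derivative_def o_def blinfun.scaleR_right)
qed

text \<open>At the ends of a piece, \<open>velocity\<close> involves two-sided derivatives, which need not exist.
  The length of the one-sided variant is continuous up to the ends, hence integrable.\<close>

definition velocity_within :: "real set \<Rightarrow> (real \<Rightarrow> 'm) \<Rightarrow> real \<Rightarrow> ('m, 'b) tangent" where
  "velocity_within T \<alpha> t =
     {(c, \<alpha> t, vector_derivative (snd c \<circ> \<alpha>) (at t within T)) | c. c \<in> A \<and> \<alpha> t \<in> fst c}"

text \<open>One chart determines the derivative in all others. Nontriviality of the filter makes the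
  derivative unique, so that \<open>vector_derivative\<close> really denotes it.\<close>

lemma velocity_within_eq:
  assumes "c \<in> A" "\<alpha> t \<in> fst c" "t \<in> T" "at t within T \<noteq> bot"
    and "\<forall>\<^sub>F s in at t within T. \<alpha> s \<in> fst c"
    and "(snd c \<circ> \<alpha> has_vector_derivative w) (at t within T)"
  shows "velocity_within T \<alpha> t = tangent_vector A c (\<alpha> t) w"
proof -
  have "vector_derivative (snd c' \<circ> \<alpha>) (at t within T) = Dtrans c c' (\<alpha> t) w"
    if "c' \<in> A" "\<alpha> t \<in> fst c'" for c'
    using assms that
    by (intro vector_derivative_within has_vector_derivative_change_chart) auto
  then show ?thesis
    unfolding velocity_within_def tangent_vector_eq[OF assms(1,2)]
    by (intro Collect_cong ex_cong1) auto
qed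

lemma velocity_eq:
  assumes "c \<in> A" "\<alpha> t \<in> fst c" "\<forall>\<^sub>F s in at t. \<alpha> s \<in> fst c"
    and "(snd c \<circ> \<alpha> has_vector_derivative w) (at t)"
  shows "velocity A \<alpha> t = tangent_vector A c (\<alpha> t) w"
  using velocity_within_eq[of c \<alpha> t UNIV w] assms
  by (simp add: velocity_def velocity_within_def)

lemma velocity_cong:
  assumes "\<forall>\<^sub>F s in nhds t. \<alpha> s = \<beta> s"
  shows "velocity A \<alpha> t = velocity A \<beta> t"
proof -
  have "vector_derivative (f \<circ> \<alpha>) (at t) = vector_derivative (f \<circ> \<beta>) (at t)" for f :: "'m \<Rightarrow> 'b"
    by (rule vector_derivative_cong_eq) (use assms in \<open>auto elim: eventually_mono\<close>)
  moreover have "\<alpha> t = \<beta> t" using assms by (rule eventually_nhds_x_imp_x)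
  ultimately show ?thesis unfolding velocity_def by simp
qed

lemma C1_curve_onE:
  assumes "C1_curve_on A a b \<alpha>"
  obtains D where
    "\<And>c t. \<lbrakk>c \<in> A; t \<in> {a..b}; \<alpha> t \<in> fst c\<rbrakk>
      \<Longrightarrow> (snd c \<circ> \<alpha> has_vector_derivative D c t) (at t within {a..b})"
    "\<And>c. c \<in> A \<Longrightarrow> continuous_on ({a..b} \<inter> \<alpha> -` fst c) (D c)"
proof -
  have "\<forall>c\<in>A. \<exists>\<alpha>'. (\<forall>t\<in>{a..b} \<inter> \<alpha> -` fst c.
        (snd c \<circ> \<alpha> has_vector_derivative \<alpha>' t) (at t within {a..b})) \<and>
      continuous_on ({a..b} \<inter> \<alpha> -` fst c) \<alpha>'"
    using assms unfolding C1_curve_on_def by (simp add: case_prod_unfold)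
  then obtain D where D: "\<forall>c\<in>A. (\<forall>t\<in>{a..b} \<inter> \<alpha> -` fst c.
        (snd c \<circ> \<alpha> has_vector_derivative D c t) (at t within {a..b})) \<and>
      continuous_on ({a..b} \<inter> \<alpha> -` fst c) (D c)"
    by (rule bchoice[THEN exE])
  show ?thesis by (rule that[of D]) (use D in blast)+
qed

lemma C1_curve_onI:
  assumes "continuous_map (top_of_set {a..b}) X \<alpha>"
    and "\<And>c t. \<lbrakk>c \<in> A; t \<in> {a..b}; \<alpha> t \<in> fst c\<rbrakk>
      \<Longrightarrow> (snd c \<circ> \<alpha> has_vector_derivative D c t) (at t within {a..b})"
    and "\<And>c. c \<in> A \<Longrightarrow> continuous_on ({a..b} \<inter> \<alpha> -` fst c) (D c)"
  shows "C1_curve_on A a b \<alpha>"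
  unfolding C1_curve_on_def case_prod_unfold
  by (intro conjI assms(1) ballI exI[of _ "D _"]) (use assms(2,3) in blast)+

text \<open>Affine changes of parameter serve both for shifting a curve (\<sigma> = 1) and for
  reversing it (\<sigma> = -1).\<close>

lemma C1_curve_on_compose:
  assumes "C1_curve_on A a b \<alpha>"
    and h: "\<And>t. t \<in> {a'..b'} \<Longrightarrow> \<sigma> * t + k \<in> {a..b}"
  shows "C1_curve_on A a' b' (\<lambda>t. \<alpha> (\<sigma> * t + k))"
proof -
  obtain D where D: "\<And>c t. \<lbrakk>c \<in> A; t \<in> {a..b}; \<alpha> t \<in> fst c\<rbrakk>
      \<Longrightarrow> (snd c \<circ> \<alpha> has_vector_derivative D c t) (at t within {a..b})"
    and cont: "\<And>c. c \<in> A \<Longrightarrow> continuous_on ({a..b} \<inter> \<alpha> -` fst c) (D c)"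
    using C1_curve_onE[OF assms(1)] by blast
  show ?thesis
  proof (rule C1_curve_onI)
    let ?h = "\<lambda>t. \<sigma> * t + k"
    have "continuous_map (top_of_set {a'..b'}) (top_of_set {a..b}) ?h"
      using h by (auto intro!: continuous_intros)
    moreover have "continuous_map (top_of_set {a..b}) X \<alpha>" using assms by (simp add: C1_curve_on_def)
    ultimately have "continuous_map (top_of_set {a'..b'}) X (\<alpha> \<circ> ?h)" by (rule continuous_map_compose)
    then show "continuous_map (top_of_set {a'..b'}) X (\<lambda>t. \<alpha> (\<sigma> * t + k))" by (simp add: o_def)
    show "(snd c \<circ> (\<lambda>t. \<alpha> (?h t)) has_vector_derivative \<sigma> *\<^sub>R D c (?h t)) (at t within {a'..b'})"
      if "c \<in> A" "t \<in> {a'..b'}" "\<alpha> (?h t) \<in> fst c" for c t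
    proof -
      have "((snd c \<circ> \<alpha>) \<circ> ?h has_vector_derivative \<sigma> *\<^sub>R D c (?h t)) (at t within {a'..b'})"
      proof (rule vector_diff_chain_within)
        show "(?h has_vector_derivative \<sigma>) (at t within {a'..b'})"
          by (auto intro!: derivative_eq_intros simp flip: has_real_derivative_iff_has_vector_derivative)
        show "(snd c \<circ> \<alpha> has_vector_derivative D c (?h t)) (at (?h t) within ?h ` {a'..b'})"
          by (rule has_vector_derivative_within_subset[OF D]) (use h that in auto)
      qed
      then show ?thesis by (simp add: o_def)
    qed
    show "continuous_on ({a'..b'} \<inter> (\<lambda>t. \<alpha> (?h t)) -` fst c) (\<lambda>t. \<sigma> *\<^sub>R D c (?h t))" if "c \<in> A" for c
      by (intro continuous_intros continuous_on_compose2[OF cont[OF that]]) (use h in auto)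
  qed
qed

lemma C1_curve_on_cong:
  assumes "C1_curve_on A a b \<alpha>" and eq: "\<And>t. t \<in> {a..b} \<Longrightarrow> \<alpha> t = \<beta> t"
  shows "C1_curve_on A a b \<beta>"
proof -
  obtain D where D: "\<And>c t. \<lbrakk>c \<in> A; t \<in> {a..b}; \<alpha> t \<in> fst c\<rbrakk>
      \<Longrightarrow> (snd c \<circ> \<alpha> has_vector_derivative D c t) (at t within {a..b})"
    and cont: "\<And>c. c \<in> A \<Longrightarrow> continuous_on ({a..b} \<inter> \<alpha> -` fst c) (D c)"
    using C1_curve_onE[OF assms(1)] by blast
  show ?thesis
  proof (rule C1_curve_onI)
    show "continuous_map (top_of_set {a..b}) X \<beta>"
      using assms by (auto simp: C1_curve_on_def intro: continuous_map_eq)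
    show "(snd c \<circ> \<beta> has_vector_derivative D c t) (at t within {a..b})"
      if "c \<in> A" "t \<in> {a..b}" "\<beta> t \<in> fst c" for c t
      by (rule has_vector_derivative_transform[OF that(2) _ D[OF that(1,2)]]) (use eq that in auto)
    have "{a..b} \<inter> \<alpha> -` fst c = {a..b} \<inter> \<beta> -` fst c" for c using eq by auto
    then show "continuous_on ({a..b} \<inter> \<beta> -` fst c) (D c)" if "c \<in> A" for c
      using cont[OF that] by metis
  qed
qed

text \<open>In \<open>c\<close> the derivative is the constant \<open>w\<close>. In any other chart
  it is \<open>Dtrans\<close> applied to \<open>w\<close>, and its continuity is the continuity of
  the derivatives of the changes of charts.\<close>

lemma C1_curve_on_segment:
  assumes "c \<in> A"
    and seg: "\<And>t. t \<in> {0..1} \<Longrightarrow> z + t *\<^sub>R w \<in> snd c ` fst c"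
  defines "\<alpha> \<equiv> \<lambda>t. inv_into (fst c) (snd c) (z + t *\<^sub>R w)"
  shows "C1_curve_on A 0 1 \<alpha>"
proof (rule C1_curve_onI)
  let ?l = "\<lambda>t. z + t *\<^sub>R w"
  have \<alpha>: "\<alpha> t \<in> fst c" "snd c (\<alpha> t) = ?l t" if "t \<in> {0..1}" for t
    using inv_into_into[OF seg[OF that]] f_inv_into_f[OF seg[OF that]] by (simp_all add: \<alpha>_def)
  have "openin (top_of_set {0..1}) {t \<in> {0..1}. \<alpha> t \<in> W}" if W: "openin X W" for W
  proof -
    have "\<alpha> t \<in> W \<longleftrightarrow> ?l t \<in> snd c ` (W \<inter> fst c)" if "t \<in> {0..1}" for t
      using \<alpha>[OF that] inj_on_image_mem_iff[OF chart_inj[OF assms(1)], of "\<alpha> t" "W \<inter> fst c"] by simp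
    then have "{t \<in> {0..1}. \<alpha> t \<in> W} = {0..1} \<inter> ?l -` (snd c ` (W \<inter> fst c))" by auto
    moreover have "open (?l -` (snd c ` (W \<inter> fst c)))"
      by (intro open_vimage open_image_chart W assms continuous_intros)
    ultimately show ?thesis by (metis openin_open)
  qed
  moreover have "\<alpha> t \<in> points A" if "t \<in> {0..1}" for t
    using \<alpha>(1)[OF that] assms(1) mem_points_iff by blast
  ultimately show cont: "continuous_map (top_of_set {0..1}) X \<alpha>"
    by (auto simp: continuous_map_def)
  have l': "(?l has_vector_derivative w) (at t within {0..1})" for t
    by (auto intro!: derivative_eq_intros)
  have d: "(snd c \<circ> \<alpha> has_vector_derivative w) (at t within {0..1})" if "t \<in> {0..1}" for t
    by (rule has_vector_derivative_transform[OF that _ l']) (use \<alpha> in auto)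
  show "(snd c' \<circ> \<alpha> has_vector_derivative Dtrans c c' (\<alpha> t) w) (at t within {0..1})"
    if "c' \<in> A" "t \<in> {0..1}" "\<alpha> t \<in> fst c'" for c' t
    using \<alpha> that assms(1)
    by (intro has_vector_derivative_change_chart eventually_in_chart[OF cont] d) auto
  show "continuous_on ({0..1} \<inter> \<alpha> -` fst c') (\<lambda>t. Dtrans c c' (\<alpha> t) w)" if c': "c' \<in> A" for c'
  proof -
    have "?l t \<in> snd c ` (fst c \<inter> fst c')" if "t \<in> {0..1} \<inter> \<alpha> -` fst c'" for t
      using \<alpha>[of t] that by (metis IntD1 IntD2 IntI image_eqI vimageE)
    then have "continuous_on ({0..1} \<inter> \<alpha> -` fst c')
        (\<lambda>t. (Dtrans c c' \<circ> inv_into (fst c) (snd c)) (?l t))"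
      by (intro continuous_on_compose2[OF continuous_on_Dtrans[OF assms(1) c']])
         (auto intro!: continuous_intros)
    then have "continuous_on ({0..1} \<inter> \<alpha> -` fst c') (\<lambda>t. Dtrans c c' (\<alpha> t))"
      by (simp add: \<alpha>_def)
    then show ?thesis by (intro continuous_intros)
  qed
qed

end

subsection \<open>Continuous norms\<close>

locale normed_manifold = C1_manifold A for A :: "('m, 'b::banach) chart set" +
  fixes nrm :: "('m, 'b) tangent \<Rightarrow> real"
  assumes cnrm: "continuous_norm A nrm"
begin

lemma nrm_scaleR:
  assumes "c \<in> A" "x \<in> fst c"
  shows "nrm (tangent_vector A c x (r *\<^sub>R v)) = \<bar>r\<bar> * nrm (tangent_vector A c x v)"
proof -
  have "x \<in> points A" using assms mem_points_iff by blast
  moreover have "tangent_vector A c x v \<in> tangent_space A x" using tangent_space_eq[OF assms] by simp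
  ultimately show ?thesis using cnrm
    unfolding continuous_norm_def tangent_scale_vector[OF assms, symmetric] by blast
qed

lemma nrm_nonneg:
  assumes "c \<in> A" "x \<in> fst c"
  shows "0 \<le> nrm (tangent_vector A c x v)"
proof -
  have "x \<in> points A" using assms mem_points_iff by blast
  moreover have "tangent_vector A c x v \<in> tangent_space A x" using tangent_space_eq[OF assms] by simp
  ultimately show ?thesis using cnrm unfolding continuous_norm_def by blast
qed

lemma nrm_equivalent:
  assumes "c \<in> A" "x \<in> fst c"
  obtains m M where "0 < m" "0 < M" "\<And>v. m * norm v \<le> nrm (tangent_vector A c x v)"
    "\<And>v. nrm (tangent_vector A c x v) \<le> M * norm v"
proof -
  have "x \<in> points A" using assms mem_points_iff by blast
  then have "\<forall>c\<in>A. x \<in> fst c \<longrightarrow> (\<exists>m M. 0 < m \<and> 0 < M \<and>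
      (\<forall>v. m * norm v \<le> nrm (tangent_vector A c x v) \<and>
           nrm (tangent_vector A c x v) \<le> M * norm v))"
    using cnrm unfolding continuous_norm_def by simp
  then have "\<exists>m M. 0 < m \<and> 0 < M \<and> (\<forall>v. m * norm v \<le> nrm (tangent_vector A c x v) \<and>
      nrm (tangent_vector A c x v) \<le> M * norm v)"
    using assms by (metis (no_types))
  then show ?thesis using that by (metis (no_types))
qed

text \<open>The continuity condition read in the natural trivialization of \<open>c\<close>. One
  neighborhood and one \<delta> serve all unit vectors \<open>v\<close> at \<open>x\<close>.\<close>

lemma nrm_uniformly_continuous:
  assumes "c \<in> A" "x \<in> fst c" "0 < \<epsilon>"
  obtains W \<delta> where "openin X W" "x \<in> W" "W \<subseteq> fst c" "0 < \<delta>"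
    "\<And>v x' v'. \<lbrakk>nrm (tangent_vector A c x v) = 1; x' \<in> W; norm (v' - v) < \<delta>\<rbrakk>
      \<Longrightarrow> \<bar>1 - nrm (tangent_vector A c x' v')\<bar> < \<epsilon>"
proof -
  let ?D = "{p \<in> tangent_space A x. nrm p = 1}"
  have "x \<in> points A" using assms mem_points_iff by blast
  then have "fibrewise_uniformly_continuous_around A nrm x ?D"
    using cnrm unfolding continuous_norm_def by blast
  then have "\<exists>W. openin X W \<and> x \<in> W \<and> W \<subseteq> fst c \<and> (\<exists>\<delta>>0. \<forall>v. (x, v) \<in> chart_triv c ` ?D \<longrightarrow>
      (\<forall>x'\<in>W. \<forall>v'. norm (v' - v) < \<delta> \<longrightarrow>
        \<bar>(nrm \<circ> inv_into (tangent_bundle_over A (fst c)) (chart_triv c)) (x, v) -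
         (nrm \<circ> inv_into (tangent_bundle_over A (fst c)) (chart_triv c)) (x', v')\<bar> < \<epsilon>))"
    using local_trivialization_chart[OF assms(1)] assms(2,3)
    unfolding fibrewise_uniformly_continuous_around_def Let_def by blast
  then obtain W \<delta> where W: "openin X W" "x \<in> W" "W \<subseteq> fst c" "\<delta> > 0"
    and *: "\<And>v x' v'. \<lbrakk>(x, v) \<in> chart_triv c ` ?D; x' \<in> W; norm (v' - v) < \<delta>\<rbrakk> \<Longrightarrow>
        \<bar>(nrm \<circ> inv_into (tangent_bundle_over A (fst c)) (chart_triv c)) (x, v) -
         (nrm \<circ> inv_into (tangent_bundle_over A (fst c)) (chart_triv c)) (x', v')\<bar> < \<epsilon>"
    by blast
  have "\<bar>1 - nrm (tangent_vector A c x' v')\<bar> < \<epsilon>"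
    if v: "nrm (tangent_vector A c x v) = 1" and "x' \<in> W" "norm (v' - v) < \<delta>" for v x' v'
  proof -
    have "(x, v) = chart_triv c (tangent_vector A c x v)"
      using assms by (simp add: chart_triv_tangent_vector Dtrans_id)
    moreover have "tangent_vector A c x v \<in> ?D"
      using v tangent_space_eq[OF assms(1,2)] by simp
    ultimately have "(x, v) \<in> chart_triv c ` ?D" by (rule image_eqI)
    from *[OF this that(2,3)] that(2) W(3) assms v show ?thesis
      by (simp add: inv_chart_triv subset_iff)
  qed
  with W that show ?thesis by blast
qed

text \<open>With \<epsilon> = 1/2, the norm at \<open>y\<close> of a vector that is a unit vector at
  \<open>x\<close> lies between 1/2 and 3/2. Homogeneity extends this to all vectors; relaxing 3/2
  to 2 gives a symmetric comparison and hence the constants \<open>m/2\<close> and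
  \<open>2*M\<close>.\<close>

lemma nrm_locally_equivalent:
  assumes "c \<in> A" "x \<in> fst c"
  obtains W m M where "openin X W" "x \<in> W" "W \<subseteq> fst c" "0 < m" "0 < M"
    "\<And>y v. y \<in> W \<Longrightarrow> m * norm v \<le> nrm (tangent_vector A c y v)"
    "\<And>y v. y \<in> W \<Longrightarrow> nrm (tangent_vector A c y v) \<le> M * norm v"
proof -
  obtain m M where m: "0 < m" "0 < M" "\<And>v. m * norm v \<le> nrm (tangent_vector A c x v)"
    "\<And>v. nrm (tangent_vector A c x v) \<le> M * norm v"
    using nrm_equivalent[OF assms] by blast
  obtain W \<delta> where W: "openin X W" "x \<in> W" "W \<subseteq> fst c" and "0 < \<delta>"
    and *: "\<And>v x' v'. \<lbrakk>nrm (tangent_vector A c x v) = 1; x' \<in> W; norm (v' - v) < \<delta>\<rbrakk>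
      \<Longrightarrow> \<bar>1 - nrm (tangent_vector A c x' v')\<bar> < 1/2"
    using nrm_uniformly_continuous[OF assms, of "1/2"] by auto
  have bound: "nrm (tangent_vector A c x v) \<le> 2 * nrm (tangent_vector A c y v) \<and>
      nrm (tangent_vector A c y v) \<le> 2 * nrm (tangent_vector A c x v)" if y: "y \<in> W" for y v
  proof (cases "v = 0")
    case True
    then show ?thesis using nrm_scaleR[of c _ 0 v] assms W y by (auto simp: subset_iff)
  next
    case False
    define k where "k = nrm (tangent_vector A c x v)"
    have k: "k > 0" using m(1) m(3)[of v] False
      by (smt (verit) k_def mult_pos_pos zero_less_norm_iff)
    \<comment> \<open>Both foot points are given the same coordinate vector, so its distance 0 is
      below \<delta> and only the foot point moves.\<close>
    have "nrm (tangent_vector A c x ((1/k) *\<^sub>R v)) = 1"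
      using k unfolding nrm_scaleR[OF assms] by (simp add: k_def)
    from *[OF this y, of "(1/k) *\<^sub>R v"] \<open>\<delta> > 0\<close>
    have "\<bar>1 - nrm (tangent_vector A c y ((1/k) *\<^sub>R v))\<bar> < 1/2" by simp
    moreover have "nrm (tangent_vector A c y ((1/k) *\<^sub>R v)) = nrm (tangent_vector A c y v) / k"
      using nrm_scaleR[of c y "1/k" v] assms W y k by (auto simp: subset_iff)
    ultimately have "1/2 \<le> nrm (tangent_vector A c y v) / k" "nrm (tangent_vector A c y v) / k \<le> 2"
      by linarith+
    then show ?thesis using k by (simp add: field_simps flip: k_def)
  qed
  show ?thesis
  proof (rule that[OF W, of "m/2" "2*M"])
    fix y v assume "y \<in> W"
    with bound[OF this, of v] m(3,4)[of v]
    show "m/2 * norm v \<le> nrm (tangent_vector A c y v)"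
      "nrm (tangent_vector A c y v) \<le> 2 * M * norm v" by linarith+
  qed (use m in auto)
qed

text \<open>Joint continuity in foot point and vector. The hypothesis concerns the unit sphere only:
  a nonzero limit \<open>v\<close> is brought there by scaling, and the limit 0 is handled by the
  local upper bound.\<close>

lemma tendsto_nrm:
  assumes "c \<in> A" "x \<in> fst c" and f: "limitin X f x F" and g: "(g \<longlongrightarrow> v) F"
  shows "((\<lambda>t. nrm (tangent_vector A c (f t) (g t))) \<longlongrightarrow> nrm (tangent_vector A c x v)) F"
proof (cases "v = 0")
  case True
  obtain W m M where W: "openin X W" "x \<in> W" "W \<subseteq> fst c" "0 < M"
    "\<And>y v. y \<in> W \<Longrightarrow> nrm (tangent_vector A c y v) \<le> M * norm v"
    using nrm_locally_equivalent[OF assms(1,2)] by metis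
  have "\<forall>\<^sub>F t in F. f t \<in> W" using f W by (auto simp: limitin_def)
  then have *: "\<forall>\<^sub>F t in F. norm (nrm (tangent_vector A c (f t) (g t))) \<le> M * norm (g t)"
    by eventually_elim (use W assms nrm_nonneg in \<open>auto simp: subset_iff\<close>)
  have "((\<lambda>t. M * norm (g t)) \<longlongrightarrow> 0) F"
    using tendsto_mult_left[OF tendsto_norm[OF g], of M] True by simp
  then have "((\<lambda>t. nrm (tangent_vector A c (f t) (g t))) \<longlongrightarrow> 0) F"
    by (rule Lim_null_comparison[OF *])
  moreover have "nrm (tangent_vector A c x v) = 0"
    using nrm_scaleR[OF assms(1,2), of 0 v] True by simp
  ultimately show ?thesis by simp
next
  case False
  define k where "k = nrm (tangent_vector A c x v)"
  obtain m where m: "0 < m" "\<And>v. m * norm v \<le> nrm (tangent_vector A c x v)"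
    using nrm_equivalent[OF assms(1,2)] by metis
  have k: "k > 0" using m(1) m(2)[of v] False
    by (smt (verit) k_def mult_pos_pos zero_less_norm_iff)
  have k1: "nrm (tangent_vector A c x ((1/k) *\<^sub>R v)) = 1"
    using k unfolding nrm_scaleR[OF assms(1,2)] by (simp add: k_def)
  have "((\<lambda>t. nrm (tangent_vector A c (f t) ((1/k) *\<^sub>R g t))) \<longlongrightarrow> 1) F"
  proof (rule tendstoI)
    fix e :: real assume "e > 0"
    obtain W \<delta> where W: "openin X W" "x \<in> W" and "0 < \<delta>"
      and *: "\<And>v x' v'. \<lbrakk>nrm (tangent_vector A c x v) = 1; x' \<in> W; norm (v' - v) < \<delta>\<rbrakk>
        \<Longrightarrow> \<bar>1 - nrm (tangent_vector A c x' v')\<bar> < e"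
      using nrm_uniformly_continuous[OF assms(1,2) \<open>e > 0\<close>] by metis
    have "\<forall>\<^sub>F t in F. f t \<in> W" using f W by (auto simp: limitin_def)
    moreover have "((\<lambda>t. (1/k) *\<^sub>R g t) \<longlongrightarrow> (1/k) *\<^sub>R v) F"
      by (intro tendsto_intros g)
    then have "\<forall>\<^sub>F t in F. dist ((1/k) *\<^sub>R g t) ((1/k) *\<^sub>R v) < \<delta>"
      using \<open>\<delta> > 0\<close> by (rule tendstoD)
    ultimately show "\<forall>\<^sub>F t in F. dist (nrm (tangent_vector A c (f t) ((1/k) *\<^sub>R g t))) 1 < e"
      by eventually_elim (use *[OF k1] in \<open>auto simp: dist_norm abs_minus_commute\<close>)
  qed
  from tendsto_mult_left[OF this, of k]
  have "((\<lambda>t. k * nrm (tangent_vector A c (f t) ((1/k) *\<^sub>R g t))) \<longlongrightarrow> k) F" by simp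
  moreover have "\<forall>\<^sub>F t in F. f t \<in> fst c"
    using f openin_chart_domain[OF assms(1)] assms(2) by (auto simp: limitin_def)
  then have "\<forall>\<^sub>F t in F. k * nrm (tangent_vector A c (f t) ((1/k) *\<^sub>R g t)) =
      nrm (tangent_vector A c (f t) (g t))"
    by eventually_elim (use k nrm_scaleR[OF assms(1)] in auto)
  ultimately show ?thesis unfolding k_def[symmetric] by (rule Lim_transform_eventually)
qed

subsection \<open>Speed and length\<close>

lemma continuous_on_speed_within:
  assumes "C1_curve_on A a b \<alpha>" "a < b"
  shows "continuous_on {a..b} (\<lambda>t. nrm (velocity_within {a..b} \<alpha> t))"
proof (clarsimp simp only: continuous_on_def)
  fix t assume t: "t \<in> {a..b}"
  have cont: "continuous_map (top_of_set {a..b}) X \<alpha>" using assms by (simp add: C1_curve_on_def)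
  obtain D where D: "\<And>c t. \<lbrakk>c \<in> A; t \<in> {a..b}; \<alpha> t \<in> fst c\<rbrakk>
      \<Longrightarrow> (snd c \<circ> \<alpha> has_vector_derivative D c t) (at t within {a..b})"
    and D': "\<And>c. c \<in> A \<Longrightarrow> continuous_on ({a..b} \<inter> \<alpha> -` fst c) (D c)"
    using C1_curve_onE[OF assms(1)] by blast
  have "\<alpha> t \<in> points A" using cont t continuous_map_image_subset_topspace by fastforce
  then obtain c where c: "c \<in> A" "\<alpha> t \<in> fst c" using mem_points_iff by blast
  have eq: "velocity_within {a..b} \<alpha> s = tangent_vector A c (\<alpha> s) (D c s)"
    if "s \<in> {a..b}" "\<alpha> s \<in> fst c" for s
    using that c D assms(2)
    by (intro velocity_within_eq eventually_in_chart[OF cont]) (auto simp: trivial_limit_within)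
  have ev: "\<forall>\<^sub>F s in at t within {a..b}. \<alpha> s \<in> fst c"
    using eventually_in_chart[OF cont t] c by blast
  have "(D c \<longlongrightarrow> D c t) (at t within {a..b} \<inter> \<alpha> -` fst c)"
    using D'[OF c(1)] t c by (auto simp: continuous_on_def)
  \<comment> \<open>\<open>D c\<close> is controlled only where the curve is in the chart domain.
    Near \<open>t\<close> this is everywhere in \<open>{a..b}\<close>, so the restriction of the
    filter can be lifted.\<close>
  then have lim: "(D c \<longlongrightarrow> D c t) (at t within {a..b})"
  proof (intro topological_tendstoI)
    fix S assume "open S" "D c t \<in> S"
    with \<open>(D c \<longlongrightarrow> D c t) _\<close> have "\<forall>\<^sub>F s in at t within {a..b} \<inter> \<alpha> -` fst c. D c s \<in> S"
      by (rule topological_tendstoD)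
    with ev show "\<forall>\<^sub>F s in at t within {a..b}. D c s \<in> S"
      unfolding eventually_at_filter by eventually_elim auto
  qed
  have "((\<lambda>s. nrm (tangent_vector A c (\<alpha> s) (D c s))) \<longlongrightarrow> nrm (tangent_vector A c (\<alpha> t) (D c t)))
      (at t within {a..b})"
    by (rule tendsto_nrm[OF c limitin_continuous_map_within[OF cont t] lim])
  moreover have "\<forall>\<^sub>F s in at t within {a..b}. s \<in> {a..b}"
    by (simp add: eventually_at_filter)
  then have "\<forall>\<^sub>F s in at t within {a..b}.
      nrm (tangent_vector A c (\<alpha> s) (D c s)) = nrm (velocity_within {a..b} \<alpha> s)"
    using ev by eventually_elim (simp add: eq)
  ultimately show "((\<lambda>s. nrm (velocity_within {a..b} \<alpha> s)) \<longlongrightarrow> nrm (velocity_within {a..b} \<alpha> t))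
      (at t within {a..b})"
    unfolding eq[OF t c(2)] by (rule Lim_transform_eventually)
qed

definition rectifiable :: "real \<Rightarrow> real \<Rightarrow> (real \<Rightarrow> 'm) \<Rightarrow> bool" where
  "rectifiable a b \<alpha> \<longleftrightarrow>
     continuous_map (top_of_set {a..b}) X \<alpha> \<and>
     (\<lambda>t. nrm (velocity A \<alpha> t)) integrable_on {a..b} \<and>
     (\<exists>S. finite S \<and> (\<forall>t\<in>{a<..<b} - S. \<forall>c\<in>A. \<alpha> t \<in> fst c \<longrightarrow> (snd c \<circ> \<alpha>) differentiable (at t)))"

lemma rectifiable_C1:
  assumes "C1_curve_on A a b \<alpha>" "a < b"
  shows "rectifiable a b \<alpha>"
proof -
  have cont: "continuous_map (top_of_set {a..b}) X \<alpha>" using assms by (simp add: C1_curve_on_def)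
  obtain D where D: "\<And>c t. \<lbrakk>c \<in> A; t \<in> {a..b}; \<alpha> t \<in> fst c\<rbrakk>
      \<Longrightarrow> (snd c \<circ> \<alpha> has_vector_derivative D c t) (at t within {a..b})"
    and "\<And>c. c \<in> A \<Longrightarrow> continuous_on ({a..b} \<inter> \<alpha> -` fst c) (D c)"
    using C1_curve_onE[OF assms(1)] by blast
  have within: "at t within {a..b} = at t" if "t \<in> {a<..<b}" for t
    using that by (simp add: at_within_Icc_at)
  have d: "(snd c \<circ> \<alpha>) differentiable (at t)" if "t \<in> {a<..<b}" "c \<in> A" "\<alpha> t \<in> fst c" for t c
    using D[of c t] that within[OF that(1)] by (auto intro: differentiableI_vector)
  have "velocity A \<alpha> t = velocity_within {a..b} \<alpha> t" if "t \<in> {a..b} - {a, b}" for t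
    using within[of t] that unfolding velocity_def velocity_within_def by auto
  then have "(\<lambda>t. nrm (velocity A \<alpha> t)) integrable_on {a..b}"
    by (intro integrable_spike_finite[OF _ _
        integrable_continuous_interval[OF continuous_on_speed_within[OF assms]], of "{a, b}"]) auto
  with cont d show ?thesis unfolding rectifiable_def by blast
qed

lemma rectifiable_combine:
  assumes "rectifiable a b \<alpha>" "rectifiable b c \<alpha>" "a \<le> b" "b \<le> c"
  shows "rectifiable a c \<alpha>"
proof -
  obtain S T where S: "finite S" "\<forall>t\<in>{a<..<b} - S. \<forall>c\<in>A. \<alpha> t \<in> fst c \<longrightarrow> (snd c \<circ> \<alpha>) differentiable (at t)"
    and T: "finite T" "\<forall>t\<in>{b<..<c} - T. \<forall>c\<in>A. \<alpha> t \<in> fst c \<longrightarrow> (snd c \<circ> \<alpha>) differentiable (at t)"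
    using assms(1,2) unfolding rectifiable_def by blast
  have ab: "continuous_map (top_of_set {a..b}) X \<alpha>" and bc: "continuous_map (top_of_set {b..c}) X \<alpha>"
    using assms unfolding rectifiable_def by auto
  have un: "{a..c} = {a..b} \<union> {b..c}" using assms by auto
  have "closedin (top_of_set {a..c}) {t \<in> {a..c}. \<alpha> t \<in> C}" if "closedin X C" for C
  proof -
    have "closed {t \<in> {a..b}. \<alpha> t \<in> C}" "closed {t \<in> {b..c}. \<alpha> t \<in> C}"
      using closedin_continuous_map_preimage[OF ab that] closedin_continuous_map_preimage[OF bc that]
      by (auto intro: closedin_closed_trans)
    then have "closed ({t \<in> {a..b}. \<alpha> t \<in> C} \<union> {t \<in> {b..c}. \<alpha> t \<in> C})" by (rule closed_Un)
    moreover have "{t \<in> {a..b}. \<alpha> t \<in> C} \<union> {t \<in> {b..c}. \<alpha> t \<in> C} = {t \<in> {a..c}. \<alpha> t \<in> C}"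
      unfolding un by blast
    ultimately show ?thesis by (auto intro: closed_subset)
  qed
  moreover have "\<alpha> \<in> {a..c} \<rightarrow> topspace X"
    using continuous_map_funspace[OF ab] continuous_map_funspace[OF bc] unfolding un by auto
  ultimately have "continuous_map (top_of_set {a..c}) X \<alpha>"
    by (simp add: continuous_map_closedin Pi_iff)
  moreover have "(\<lambda>t. nrm (velocity A \<alpha> t)) integrable_on {a..c}"
    using assms by (intro Henstock_Kurzweil_Integration.integrable_combine[OF assms(3,4)]) (simp_all add: rectifiable_def)
  moreover have "\<forall>t\<in>{a<..<c} - (S \<union> T \<union> {b}). \<forall>c\<in>A. \<alpha> t \<in> fst c \<longrightarrow> (snd c \<circ> \<alpha>) differentiable (at t)"
  proof
    fix t assume "t \<in> {a<..<c} - (S \<union> T \<union> {b})"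
    then have "t \<in> {a<..<b} - S \<or> t \<in> {b<..<c} - T" by auto
    with S(2) T(2) show "\<forall>c\<in>A. \<alpha> t \<in> fst c \<longrightarrow> (snd c \<circ> \<alpha>) differentiable (at t)" by blast
  qed
  then have "\<exists>S. finite S \<and> (\<forall>t\<in>{a<..<c} - S. \<forall>c\<in>A. \<alpha> t \<in> fst c \<longrightarrow> (snd c \<circ> \<alpha>) differentiable (at t))"
    using S(1) T(1) by (intro exI[of _ "S \<union> T \<union> {b}"]) simp
  ultimately show ?thesis unfolding rectifiable_def by blast
qed

lemma rectifiable_piecewise:
  assumes "piecewise_C1_curve A a b \<alpha>"
  shows "rectifiable a b \<alpha>"
proof -
  obtain n s where s: "a < b" "s 0 = a" "s n = b"
    "\<And>i. i < n \<Longrightarrow> s i < s (Suc i)" "\<And>i. i < n \<Longrightarrow> C1_curve_on A (s i) (s (Suc i)) \<alpha>"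
    using assms unfolding piecewise_C1_curve_def by blast
  have "k < n \<Longrightarrow> s 0 < s (Suc k) \<and> rectifiable (s 0) (s (Suc k)) \<alpha>" for k
  proof (induction k)
    case 0
    then show ?case using s rectifiable_C1 by auto
  next
    case (Suc k)
    then have "s (Suc k) < s (Suc (Suc k))" "rectifiable (s (Suc k)) (s (Suc (Suc k))) \<alpha>"
      using s rectifiable_C1 by auto
    with Suc show ?case using rectifiable_combine[of "s 0" "s (Suc k)" \<alpha> "s (Suc (Suc k))"] by auto
  qed
  from this[of "n - 1"] s(1-3) show ?thesis by (cases n) auto
qed

lemma rectifiable_velocity:
  assumes "rectifiable a b \<alpha>"
  obtains S where "finite S"
    "\<And>t c. \<lbrakk>t \<in> {a<..<b} - S; c \<in> A; \<alpha> t \<in> fst c\<rbrakk> \<Longrightarrow>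
      (snd c \<circ> \<alpha> has_vector_derivative vector_derivative (snd c \<circ> \<alpha>) (at t)) (at t)"
    "\<And>t c. \<lbrakk>t \<in> {a<..<b} - S; c \<in> A; \<alpha> t \<in> fst c\<rbrakk> \<Longrightarrow>
      velocity A \<alpha> t = tangent_vector A c (\<alpha> t) (vector_derivative (snd c \<circ> \<alpha>) (at t))"
    "\<And>t. t \<in> {a<..<b} \<Longrightarrow> \<exists>c\<in>A. \<alpha> t \<in> fst c"
proof -
  obtain S where S: "finite S"
    "\<And>t c. \<lbrakk>t \<in> {a<..<b} - S; c \<in> A; \<alpha> t \<in> fst c\<rbrakk> \<Longrightarrow> (snd c \<circ> \<alpha>) differentiable (at t)"
    and cont: "continuous_map (top_of_set {a..b}) X \<alpha>"
    using assms unfolding rectifiable_def by blast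
  show ?thesis
  proof (rule that[OF S(1)])
    fix t c assume t: "t \<in> {a<..<b} - S" "c \<in> A" "\<alpha> t \<in> fst c"
    show d: "(snd c \<circ> \<alpha> has_vector_derivative vector_derivative (snd c \<circ> \<alpha>) (at t)) (at t)"
      using S(2)[OF t] by (simp add: vector_derivative_works)
    show "velocity A \<alpha> t = tangent_vector A c (\<alpha> t) (vector_derivative (snd c \<circ> \<alpha>) (at t))"
      using t by (intro velocity_eq d eventually_in_chart_interior[OF cont]) auto
  next
    fix t assume "t \<in> {a<..<b}"
    then have "\<alpha> t \<in> points A" using continuous_map_funspace[OF cont] by auto
    then show "\<exists>c\<in>A. \<alpha> t \<in> fst c" by (simp add: mem_points_iff)
  qed
qed

lemma rectifiable_speed_nonneg:
  assumes "rectifiable a b \<alpha>"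
  obtains S where "finite S" "\<And>t. t \<in> {a..b} - S \<Longrightarrow> 0 \<le> nrm (velocity A \<alpha> t)"
proof -
  obtain S where S: "finite S"
    "\<And>t c. \<lbrakk>t \<in> {a<..<b} - S; c \<in> A; \<alpha> t \<in> fst c\<rbrakk> \<Longrightarrow>
      velocity A \<alpha> t = tangent_vector A c (\<alpha> t) (vector_derivative (snd c \<circ> \<alpha>) (at t))"
    "\<And>t. t \<in> {a<..<b} \<Longrightarrow> \<exists>c\<in>A. \<alpha> t \<in> fst c"
    using rectifiable_velocity[OF assms] by metis
  have "0 \<le> nrm (velocity A \<alpha> t)" if "t \<in> {a<..<b} - S" for t
    using S(2)[OF that] S(3)[of t] that nrm_nonneg by fastforce
  then show ?thesis using S(1) by (intro that[of "insert a (insert b S)"]) auto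
qed

lemma curve_length_mono:
  assumes "rectifiable a b \<alpha>" "{a'..b'} \<subseteq> {a..b}"
  shows "curve_length A nrm a' b' \<alpha> \<le> curve_length A nrm a b \<alpha>"
proof -
  let ?f = "\<lambda>t. nrm (velocity A \<alpha> t)"
  obtain S where S: "finite S" "\<And>t. t \<in> {a..b} - S \<Longrightarrow> 0 \<le> ?f t"
    using rectifiable_speed_nonneg[OF assms(1)] by metis
  have int: "?f integrable_on {a..b}" using assms by (simp add: rectifiable_def)
  have eq: "integral T ?f = integral T (\<lambda>t. \<bar>?f t\<bar>)" if "T \<subseteq> {a..b}" for T
    by (rule integral_spike[OF negligible_finite[OF S(1)]]) (use S that in auto)
  have abs: "(\<lambda>t. \<bar>?f t\<bar>) integrable_on {a..b}"
    by (rule integrable_spike_finite[OF S(1) _ int]) (use S in auto)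
  then have "(\<lambda>t. \<bar>?f t\<bar>) integrable_on {a'..b'}"
    using assms(2) by (rule integrable_on_subinterval)
  then show ?thesis
    using integral_subset_le[OF assms(2) _ abs]
    unfolding curve_length_def eq[OF assms(2)] eq[OF subset_refl] by simp
qed

lemma curve_length_nonneg:
  assumes "rectifiable a b \<alpha>"
  shows "0 \<le> curve_length A nrm a b \<alpha>"
  using curve_length_mono[OF assms, of 1 0] by (simp add: curve_length_def)

lemma nrm_velocity_affine:
  assumes "rectifiable a b \<alpha>" "\<bar>\<sigma>\<bar> = 1"
  obtains S where "finite S"
    "\<And>t. \<sigma> * t + k \<in> {a<..<b} \<Longrightarrow> t \<notin> S \<Longrightarrow>
      nrm (velocity A (\<lambda>t. \<alpha> (\<sigma> * t + k)) t) = nrm (velocity A \<alpha> (\<sigma> * t + k))"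
proof -
  let ?h = "\<lambda>t. \<sigma> * t + k"
  obtain S where S: "finite S"
    "\<And>t c. \<lbrakk>t \<in> {a<..<b} - S; c \<in> A; \<alpha> t \<in> fst c\<rbrakk> \<Longrightarrow>
      (snd c \<circ> \<alpha> has_vector_derivative vector_derivative (snd c \<circ> \<alpha>) (at t)) (at t)"
    "\<And>t c. \<lbrakk>t \<in> {a<..<b} - S; c \<in> A; \<alpha> t \<in> fst c\<rbrakk> \<Longrightarrow>
      velocity A \<alpha> t = tangent_vector A c (\<alpha> t) (vector_derivative (snd c \<circ> \<alpha>) (at t))"
    "\<And>t. t \<in> {a<..<b} \<Longrightarrow> \<exists>c\<in>A. \<alpha> t \<in> fst c"
    using rectifiable_velocity[OF assms(1)] by metis
  have "\<sigma> \<noteq> 0" using assms(2) by auto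
  then have "inj ?h" by (auto simp: inj_on_def)
  then have "finite (?h -` S)" using S(1) by (rule finite_vimageI[rotated])
  moreover have "nrm (velocity A (\<lambda>t. \<alpha> (?h t)) t) = nrm (velocity A \<alpha> (?h t))"
    if t: "?h t \<in> {a<..<b}" "t \<notin> ?h -` S" for t
  proof -
    have t': "?h t \<in> {a<..<b} - S" using t by auto
    obtain c where c: "c \<in> A" "\<alpha> (?h t) \<in> fst c" using S(4)[OF t(1)] by blast
    let ?w = "vector_derivative (snd c \<circ> \<alpha>) (at (?h t))"
    have "continuous_map (top_of_set {a..b}) X \<alpha>" using assms by (simp add: rectifiable_def)
    then have "\<forall>\<^sub>F s in at (?h t). \<alpha> s \<in> fst c"
      using eventually_in_chart_interior t(1) c by blast
    then have "\<forall>\<^sub>F s in nhds (?h t). \<alpha> s \<in> fst c"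
      using c(2) by (simp add: eventually_nhds_conv_at)
    moreover have "filterlim ?h (nhds (?h t)) (at t)"
      by (intro tendsto_intros)
    ultimately have ev: "\<forall>\<^sub>F s in at t. \<alpha> (?h s) \<in> fst c" by (rule eventually_compose_filterlim)
    have "((snd c \<circ> \<alpha>) \<circ> ?h has_vector_derivative \<sigma> *\<^sub>R ?w) (at t)"
    proof (rule vector_diff_chain_at)
      show "(?h has_vector_derivative \<sigma>) (at t)"
        by (auto intro!: derivative_eq_intros simp flip: has_real_derivative_iff_has_vector_derivative)
    qed (rule S(2)[OF t' c])
    then have "velocity A (\<lambda>t. \<alpha> (?h t)) t = tangent_vector A c (\<alpha> (?h t)) (\<sigma> *\<^sub>R ?w)"
      by (intro velocity_eq c ev) (simp add: o_def)
    then show ?thesis using S(3)[OF t' c] nrm_scaleR[OF c, of \<sigma>] assms(2) by simp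
  qed
  ultimately show ?thesis by (rule that) auto
qed

subsection \<open>Concatenation of curves\<close>

lemma piecewise_shift:
  assumes "piecewise_C1_curve A a b \<alpha>"
  shows "piecewise_C1_curve A (a - k) (b - k) (\<lambda>t. \<alpha> (t + k))"
    and "curve_length A nrm (a - k) (b - k) (\<lambda>t. \<alpha> (t + k)) = curve_length A nrm a b \<alpha>"
proof -
  obtain n s where s: "a < b" "s 0 = a" "s n = b"
    "\<And>i. i < n \<Longrightarrow> s i < s (Suc i) \<and> C1_curve_on A (s i) (s (Suc i)) \<alpha>"
    using assms unfolding piecewise_C1_curve_def by blast
  have "C1_curve_on A (s i - k) (s (Suc i) - k) (\<lambda>t. \<alpha> (t + k))" if "i < n" for i
    using C1_curve_on_compose[of "s i" "s (Suc i)" \<alpha> "s i - k" "s (Suc i) - k" 1 k] s(4)[OF that]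
    by (simp add: algebra_simps)
  then show "piecewise_C1_curve A (a - k) (b - k) (\<lambda>t. \<alpha> (t + k))"
    unfolding piecewise_C1_curve_def using s
    by (intro conjI exI[of _ n] exI[of _ "\<lambda>i. s i - k"]) auto
  let ?f = "\<lambda>t. nrm (velocity A \<alpha> t)"
  obtain S where S: "finite S" "\<And>t. 1 * t + k \<in> {a<..<b} \<Longrightarrow> t \<notin> S \<Longrightarrow>
      nrm (velocity A (\<lambda>t. \<alpha> (1 * t + k)) t) = ?f (1 * t + k)"
    using nrm_velocity_affine[OF rectifiable_piecewise[OF assms], of 1 k] by auto
  have "integral {a-k..b-k} (\<lambda>t. nrm (velocity A (\<lambda>t. \<alpha> (t + k)) t)) = integral {a-k..b-k} (?f \<circ> (+) k)"
    by (rule integral_spike[OF negligible_finite[of "S \<union> {a-k, b-k}"]])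
       (use S in \<open>auto simp: add.commute\<close>)
  then show "curve_length A nrm (a - k) (b - k) (\<lambda>t. \<alpha> (t + k)) = curve_length A nrm a b \<alpha>"
    unfolding curve_length_def integral_shift_Icc_real by simp
qed

lemma piecewise_reverse:
  assumes "piecewise_C1_curve A a b \<alpha>"
  shows "piecewise_C1_curve A (-b) (-a) (\<lambda>t. \<alpha> (-t))"
    and "curve_length A nrm (-b) (-a) (\<lambda>t. \<alpha> (-t)) = curve_length A nrm a b \<alpha>"
proof -
  obtain n s where s: "a < b" "s 0 = a" "s n = b"
    "\<And>i. i < n \<Longrightarrow> s i < s (Suc i) \<and> C1_curve_on A (s i) (s (Suc i)) \<alpha>"
    using assms unfolding piecewise_C1_curve_def by blast
  have piece: "C1_curve_on A (- s (Suc i)) (- s i) (\<lambda>t. \<alpha> (-t))" if "i < n" for i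
    using C1_curve_on_compose[of "s i" "s (Suc i)" \<alpha> "- s (Suc i)" "- s i" "-1" 0] s(4)[OF that]
    by simp
  have "- s (n - i) < - s (n - Suc i) \<and> C1_curve_on A (- s (n - i)) (- s (n - Suc i)) (\<lambda>t. \<alpha> (-t))"
    if "i < n" for i
    using s(4)[of "n - Suc i"] piece[of "n - Suc i"] that by (simp add: Suc_diff_Suc)
  then show "piecewise_C1_curve A (-b) (-a) (\<lambda>t. \<alpha> (-t))"
    unfolding piecewise_C1_curve_def using s
    by (intro conjI exI[of _ n] exI[of _ "\<lambda>i. - s (n - i)"]) auto
  let ?f = "\<lambda>t. nrm (velocity A \<alpha> t)"
  obtain S where S: "finite S" "\<And>t. -1 * t + 0 \<in> {a<..<b} \<Longrightarrow> t \<notin> S \<Longrightarrow>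
      nrm (velocity A (\<lambda>t. \<alpha> (-1 * t + 0)) t) = ?f (-1 * t + 0)"
    using nrm_velocity_affine[OF rectifiable_piecewise[OF assms], of "-1" 0] by auto
  have "integral {-b..-a} (\<lambda>t. nrm (velocity A (\<lambda>t. \<alpha> (-t)) t)) = integral {-b..-a} (\<lambda>t. ?f (-t))"
    by (rule integral_spike[OF negligible_finite[of "S \<union> {-b, -a}"]])
       (use S in auto)
  also have "\<dots> = integral {a..b} ?f"
    by (rule Henstock_Kurzweil_Integration.integral_reflect_real)
  finally show "curve_length A nrm (-b) (-a) (\<lambda>t. \<alpha> (-t)) = curve_length A nrm a b \<alpha>"
    unfolding curve_length_def .
qed

lemma piecewise_concat:
  assumes "piecewise_C1_curve A a b \<alpha>" "piecewise_C1_curve A b c \<beta>" "\<alpha> b = \<beta> b"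
  defines "\<gamma> \<equiv> \<lambda>t. if t \<le> b then \<alpha> t else \<beta> t"
  shows "piecewise_C1_curve A a c \<gamma>"
    and "curve_length A nrm a c \<gamma> = curve_length A nrm a b \<alpha> + curve_length A nrm b c \<beta>"
proof -
  obtain n s where s: "a < b" "s 0 = a" "s n = b"
    "\<And>i. i < n \<Longrightarrow> s i < s (Suc i) \<and> C1_curve_on A (s i) (s (Suc i)) \<alpha>"
    using assms(1) unfolding piecewise_C1_curve_def by blast
  obtain p q where q: "b < c" "q 0 = b" "q p = c"
    "\<And>i. i < p \<Longrightarrow> q i < q (Suc i) \<and> C1_curve_on A (q i) (q (Suc i)) \<beta>"
    using assms(2) unfolding piecewise_C1_curve_def by blast
  have s_le: "i \<le> n \<Longrightarrow> s i \<le> b" for i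
    by (induction i rule: inc_induct) (use s in \<open>auto intro: order_trans less_imp_le\<close>)
  have q_ge: "i \<le> p \<Longrightarrow> b \<le> q i" for i
  proof (induction i)
    case (Suc i)
    then show ?case using q(4)[of i] by simp
  qed (use q in simp)
  have \<gamma>_eq: "\<beta> t = \<gamma> t" if "b \<le> t" for t
    using that assms(3) by (cases "t = b") (auto simp: \<gamma>_def)
  let ?s = "\<lambda>i. if i \<le> n then s i else q (i - n)"
  have "?s i < ?s (Suc i) \<and> C1_curve_on A (?s i) (?s (Suc i)) \<gamma>" if i: "i < n + p" for i
  proof (cases "i < n")
    case True
    have "C1_curve_on A (s i) (s (Suc i)) \<gamma>"
      by (rule C1_curve_on_cong[OF s(4)[OF True, THEN conjunct2]])
         (use s_le[of "Suc i"] True in \<open>auto simp: \<gamma>_def\<close>)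
    then show ?thesis using s(4)[OF True] True by simp
  next
    case False
    define j where "j = i - n"
    have j: "j < p" "i = n + j" using i False by (auto simp: j_def)
    have "C1_curve_on A (q j) (q (Suc j)) \<gamma>"
      by (rule C1_curve_on_cong[OF q(4)[OF j(1), THEN conjunct2]])
         (use q_ge[of j] j \<gamma>_eq in auto)
    then show ?thesis using q(4)[OF j(1)] j s(3) q(2) by (cases j) auto
  qed
  moreover have "0 < p" using q(1-3) by (cases p) auto
  ultimately show pw: "piecewise_C1_curve A a c \<gamma>"
    unfolding piecewise_C1_curve_def using s(1-3) q(1-3)
    by (intro conjI exI[of _ "n + p"] exI[of _ ?s]) auto
  have "velocity A \<gamma> t = velocity A \<alpha> t" if "t < b" for t
  proof (rule velocity_cong)
    have "\<forall>\<^sub>F s in nhds t. s \<in> {..<b}" using that by (intro eventually_nhds_in_open) auto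
    then show "\<forall>\<^sub>F s in nhds t. \<gamma> s = \<alpha> s" by eventually_elim (auto simp: \<gamma>_def)
  qed
  then have 1: "curve_length A nrm a b \<gamma> = curve_length A nrm a b \<alpha>"
    unfolding curve_length_def
    by (intro integral_spike[OF negligible_sing[of b]]) auto
  have "velocity A \<gamma> t = velocity A \<beta> t" if "b < t" for t
  proof (rule velocity_cong)
    have "\<forall>\<^sub>F s in nhds t. s \<in> {b<..}" using that by (intro eventually_nhds_in_open) auto
    then show "\<forall>\<^sub>F s in nhds t. \<gamma> s = \<beta> s" by eventually_elim (auto simp: \<gamma>_def)
  qed
  then have 2: "curve_length A nrm b c \<gamma> = curve_length A nrm b c \<beta>"
    unfolding curve_length_def
    by (intro integral_spike[OF negligible_sing[of b]]) auto
  have "(\<lambda>t. nrm (velocity A \<gamma> t)) integrable_on {a..c}"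
    using rectifiable_piecewise[OF pw] by (simp add: rectifiable_def)
  then have "curve_length A nrm a c \<gamma> = curve_length A nrm a b \<gamma> + curve_length A nrm b c \<gamma>"
    unfolding curve_length_def using s(1) q(1)
    by (intro Henstock_Kurzweil_Integration.integral_combine[symmetric]) auto
  with 1 2 show "curve_length A nrm a c \<gamma> = curve_length A nrm a b \<alpha> + curve_length A nrm b c \<beta>"
    by simp
qed

definition reach :: "'m \<Rightarrow> 'm \<Rightarrow> real \<Rightarrow> bool" where
  "reach x y L \<longleftrightarrow> (\<exists>a b \<alpha>. piecewise_C1_curve A a b \<alpha> \<and> \<alpha> a = x \<and> \<alpha> b = y \<and> curve_length A nrm a b \<alpha> = L)"

lemma reach_nonneg: "reach x y L \<Longrightarrow> 0 \<le> L"
  unfolding reach_def using curve_length_nonneg rectifiable_piecewise by blast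

lemma reach_sym:
  assumes "reach x y L"
  shows "reach y x L"
proof -
  obtain a b \<alpha> where "piecewise_C1_curve A a b \<alpha>" "\<alpha> a = x" "\<alpha> b = y" "curve_length A nrm a b \<alpha> = L"
    using assms unfolding reach_def by blast
  then show ?thesis unfolding reach_def using piecewise_reverse[of a b \<alpha>]
    by (intro exI[of _ "-b"] exI[of _ "-a"] exI[of _ "\<lambda>t. \<alpha> (-t)"]) simp
qed

lemma reach_trans:
  assumes "reach x y K" "reach y z L"
  shows "reach x z (K + L)"
proof -
  obtain a b \<alpha> where \<alpha>: "piecewise_C1_curve A a b \<alpha>" "\<alpha> a = x" "\<alpha> b = y" "curve_length A nrm a b \<alpha> = K"
    using assms(1) unfolding reach_def by blast
  obtain c d \<beta> where \<beta>: "piecewise_C1_curve A c d \<beta>" "\<beta> c = y" "\<beta> d = z" "curve_length A nrm c d \<beta> = L"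
    using assms(2) unfolding reach_def by blast
  define k where "k = c - b"
  have ck: "c - k = b" by (simp add: k_def)
  have lt: "a < b" "c < d" using \<alpha>(1) \<beta>(1) unfolding piecewise_C1_curve_def by auto
  note \<beta>' = piecewise_shift[OF \<beta>(1), of k, unfolded ck]
  have "\<alpha> b = \<beta> (b + k)" using \<alpha> \<beta> by (simp add: k_def)
  note * = piecewise_concat[OF \<alpha>(1) \<beta>'(1) this]
  show ?thesis unfolding reach_def
    using * \<alpha> \<beta> \<beta>'(2) lt ck
    by (intro exI[of _ a] exI[of _ "d - k"] exI[of _ "\<lambda>t. if t \<le> b then \<alpha> t else \<beta> (t + k)"]) auto
qed

lemma reach_points:
  assumes "reach x y L"
  shows "x \<in> points A" "y \<in> points A"
proof -
  obtain a b \<alpha> where \<alpha>: "piecewise_C1_curve A a b \<alpha>" "\<alpha> a = x" "\<alpha> b = y"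
    using assms unfolding reach_def by blast
  then have "a < b" "continuous_map (top_of_set {a..b}) X \<alpha>"
    using rectifiable_piecewise[OF \<alpha>(1)] by (auto simp: piecewise_C1_curve_def rectifiable_def)
  then have "\<alpha> a \<in> points A" "\<alpha> b \<in> points A"
    using continuous_map_funspace[of "top_of_set {a..b}" X \<alpha>] by auto
  with \<alpha> show "x \<in> points A" "y \<in> points A" by auto
qed

lemma reach_segment:
  assumes c: "c \<in> A" "x \<in> fst c" "y \<in> fst c"
    and r: "ball (snd c x) r \<subseteq> snd c ` fst c" "snd c y \<in> ball (snd c x) r"
    and M: "0 \<le> M" "\<And>z v. \<lbrakk>z \<in> fst c; snd c z \<in> ball (snd c x) r\<rbrakk> \<Longrightarrow>
      nrm (tangent_vector A c z v) \<le> M * norm v"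
  obtains L where "reach x y L" "L \<le> M * dist (snd c x) (snd c y)"
proof -
  define w where "w = snd c y - snd c x"
  define \<alpha> where "\<alpha> = (\<lambda>t. inv_into (fst c) (snd c) (snd c x + t *\<^sub>R w))"
  have l: "snd c x + t *\<^sub>R w \<in> ball (snd c x) r" if "t \<in> {0..1}" for t
  proof -
    have "\<bar>t\<bar> * norm w \<le> 1 * norm w" using that by (intro mult_right_mono) auto
    moreover have "norm w < r" using r(2) by (simp add: w_def dist_norm norm_minus_commute)
    ultimately show ?thesis by (simp add: dist_norm)
  qed
  then have seg: "snd c x + t *\<^sub>R w \<in> snd c ` fst c" if "t \<in> {0..1}" for t using r(1) that by blast
  have \<alpha>: "\<alpha> t \<in> fst c" "snd c (\<alpha> t) = snd c x + t *\<^sub>R w" if "t \<in> {0..1}" for t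
    using inv_into_into[OF seg[OF that]] f_inv_into_f[OF seg[OF that]] by (simp_all add: \<alpha>_def)
  have C1: "C1_curve_on A 0 1 \<alpha>"
    unfolding \<alpha>_def by (rule C1_curve_on_segment[OF c(1) seg])
  have pw: "piecewise_C1_curve A 0 1 \<alpha>"
    unfolding piecewise_C1_curve_def using C1
    by (intro conjI exI[of _ 1] exI[of _ real]) auto
  have cont: "continuous_map (top_of_set {0..1}) X \<alpha>" using C1 by (simp add: C1_curve_on_def)
  have speed: "nrm (velocity A \<alpha> t) \<le> M * norm w" if t: "t \<in> {0<..<1}" for t
  proof -
    have "((\<lambda>t. snd c x + t *\<^sub>R w) has_vector_derivative w) (at t)"
      by (auto intro!: derivative_eq_intros)
    then have "(snd c \<circ> \<alpha> has_vector_derivative w) (at t)"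
      by (rule has_vector_derivative_transform_within_open[of _ _ _ "{0<..<1}"])
         (use t \<alpha> in auto)
    then have "velocity A \<alpha> t = tangent_vector A c (\<alpha> t) w"
      using t \<alpha>(1)[of t] by (intro velocity_eq c eventually_in_chart_interior[OF cont]) auto
    then show ?thesis using M(2)[of "\<alpha> t" w] \<alpha>[of t] l[of t] t by simp
  qed
  let ?g = "\<lambda>t. if t \<in> {0, 1} then 0 else nrm (velocity A \<alpha> t)"
  have "(\<lambda>t. nrm (velocity A \<alpha> t)) integrable_on {0..1}"
    using rectifiable_piecewise[OF pw] by (simp add: rectifiable_def)
  then have "?g integrable_on {0..1}"
    by (rule integrable_spike_finite[rotated 2, of _ _ "{0, 1}"]) auto
  then have "integral {0..1} ?g \<le> integral {0..1} (\<lambda>t::real. M * norm w)"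
    by (rule integral_le) (use M(1) speed in auto)
  moreover have "curve_length A nrm 0 1 \<alpha> = integral {0..1} ?g"
    unfolding curve_length_def by (rule integral_spike[of "{0, 1}"]) auto
  ultimately have "curve_length A nrm 0 1 \<alpha> \<le> M * dist (snd c x) (snd c y)"
    by (simp add: w_def dist_norm norm_minus_commute)
  moreover have "\<alpha> 0 = x" "\<alpha> 1 = y"
    using c by (simp_all add: \<alpha>_def w_def chart_inj)
  then have "reach x y (curve_length A nrm 0 1 \<alpha>)" using pw unfolding reach_def by blast
  ultimately show ?thesis using that by blast
qed

subsection \<open>Lengths of curves and distances in a chart\<close>

lemma chart_displacement_le_length:
  assumes curve: "rectifiable a b \<alpha>" "a \<le> s" "s \<le> t" "t \<le> b"
    and c: "c \<in> A" and V: "\<And>u. u \<in> {s..t} \<Longrightarrow> \<alpha> u \<in> V" "V \<subseteq> fst c"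
    and m: "0 < m" "\<And>y v. y \<in> V \<Longrightarrow> m * norm v \<le> nrm (tangent_vector A c y v)"
  shows "m * dist (snd c (\<alpha> s)) (snd c (\<alpha> t)) \<le> curve_length A nrm s t \<alpha>"
proof -
  let ?f = "snd c \<circ> \<alpha>" and ?v = "\<lambda>u. nrm (velocity A \<alpha> u)"
  have cont: "continuous_map (top_of_set {a..b}) X \<alpha>"
    and int: "?v integrable_on {a..b}"
    using curve by (auto simp: rectifiable_def)
  obtain S where S: "finite S"
    "\<And>t c. \<lbrakk>t \<in> {a<..<b} - S; c \<in> A; \<alpha> t \<in> fst c\<rbrakk> \<Longrightarrow>
      (snd c \<circ> \<alpha> has_vector_derivative vector_derivative (snd c \<circ> \<alpha>) (at t)) (at t)"
    "\<And>t c. \<lbrakk>t \<in> {a<..<b} - S; c \<in> A; \<alpha> t \<in> fst c\<rbrakk> \<Longrightarrow>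
      velocity A \<alpha> t = tangent_vector A c (\<alpha> t) (vector_derivative (snd c \<circ> \<alpha>) (at t))"
    using rectifiable_velocity[OF curve(1)] by metis
  let ?T = "insert s (insert t S)"
  let ?f' = "\<lambda>u. if u \<in> ?T then 0 else vector_derivative ?f (at u)"
  let ?g = "\<lambda>u. if u \<in> ?T then 0 else ?v u / m"
  have inside: "u \<in> {a<..<b} - S \<and> \<alpha> u \<in> V" if "u \<in> {s..t} - ?T" for u
    using that curve V(1)[of u] by auto
  have "(?f' has_integral (?f t - ?f s)) {s..t}"
  proof (rule fundamental_theorem_of_calculus_interior_strong[of ?T])
    show "(?f has_vector_derivative ?f' u) (at u)" if "u \<in> {s<..<t} - ?T" for u
      using that S(2)[of u c] inside[of u] c V(2) by auto
    have "(?f \<longlongrightarrow> ?f u) (at u within {s..t})" if u: "u \<in> {s..t}" for u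
    proof -
      have "limitin X \<alpha> (\<alpha> u) (at u within {a..b})"
        using u curve by (intro limitin_continuous_map_within[OF cont]) auto
      then have "(?f \<longlongrightarrow> ?f u) (at u within {a..b})"
        using limitin_chart[OF c, of "\<alpha> u"] V u by (auto simp: o_def)
      then show ?thesis by (rule tendsto_within_subset) (use curve in auto)
    qed
    then show "continuous_on {s..t} ?f" unfolding continuous_on_def by blast
  qed (use S(1) curve in auto)
  moreover have "?v integrable_on {s..t}"
    by (rule integrable_on_subinterval[OF int]) (use curve in auto)
  then have v': "(\<lambda>u. ?v u / m) integrable_on {s..t}"
    using integrable_on_cmult_left[of ?v "{s..t}" "1/m"] by simp
  then have "?g integrable_on {s..t}"
    by (rule integrable_spike_finite[rotated 2, of _ _ ?T]) (use S in auto)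
  moreover have "norm (?f' u) \<le> ?g u" if "u \<in> {s..t}" for u
  proof (cases "u \<in> ?T")
    case False
    with inside[of u] that have u: "u \<in> {a<..<b} - S" "\<alpha> u \<in> V" by auto
    with V(2) have "?v u = nrm (tangent_vector A c (\<alpha> u) (vector_derivative ?f (at u)))"
      using S(3)[OF u(1) c] by auto
    with m(2)[OF u(2), of "vector_derivative ?f (at u)"] have "m * norm (vector_derivative ?f (at u)) \<le> ?v u" by simp
    then show ?thesis using False m(1) by (simp add: field_simps)
  qed auto
  ultimately have "norm (?f t - ?f s) \<le> integral {s..t} ?g"
    using integral_norm_bound_integral[of ?f' "{s..t}" ?g] integral_unique[of ?f']
    by (auto simp: has_integral_iff)
  also have "\<dots> = integral {s..t} (\<lambda>u. ?v u / m)"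
    by (rule integral_spike[OF negligible_finite[of ?T]]) (use S in auto)
  also have "\<dots> = curve_length A nrm s t \<alpha> / m"
    by (simp add: curve_length_def)
  finally show ?thesis using m(1) by (simp add: dist_norm norm_minus_commute field_simps)
qed

lemma short_curve_in_chart_ball:
  assumes H: "Hausdorff_space X" and curve: "rectifiable a b \<alpha>" "a \<le> b" "\<alpha> a = x"
    and c: "c \<in> A" "x \<in> fst c" "ball (snd c x) r \<subseteq> snd c ` fst c"
    and m: "0 < m" "\<And>y v. \<lbrakk>y \<in> fst c; snd c y \<in> ball (snd c x) r\<rbrakk> \<Longrightarrow>
      m * norm v \<le> nrm (tangent_vector A c y v)"
    and short: "curve_length A nrm a b \<alpha> < m * r"
  shows "\<alpha> b \<in> fst c" "m * dist (snd c x) (snd c (\<alpha> b)) \<le> curve_length A nrm a b \<alpha>"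
proof -
  define V where "V = {y \<in> fst c. snd c y \<in> ball (snd c x) r}"
  let ?L = "\<lambda>t. curve_length A nrm a t \<alpha>"
  have V: "openin X V" unfolding V_def by (rule openin_chart_preimage[OF c(1) open_ball])
  have m': "m * norm v \<le> nrm (tangent_vector A c y v)" if "y \<in> V" for y v
    using m(2) that by (simp add: V_def)
  have cont: "continuous_map (top_of_set {a..b}) X \<alpha>"
    and int: "(\<lambda>t. nrm (velocity A \<alpha> t)) integrable_on {a..b}"
    using curve by (auto simp: rectifiable_def)
  have "0 \<le> ?L b" using curve_length_nonneg[OF curve(1)] .
  with short m(1) have "0 < r" by (smt (verit) mult_nonneg_nonpos)
  then have xV: "x \<in> V" using c by (simp add: V_def)
  have disp: "m * dist (snd c (\<alpha> s)) (snd c (\<alpha> t)) \<le> curve_length A nrm s t \<alpha>"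
    if "a \<le> s" "s \<le> t" "t \<le> b" "\<And>u. u \<in> {s..t} \<Longrightarrow> \<alpha> u \<in> V" for s t
    by (rule chart_displacement_le_length[OF curve(1) that(1-3) c(1) that(4) _ m(1) m'])
       (auto simp: V_def)
  define S where "S = {t \<in> {a..b}. \<forall>u\<in>{a..t}. \<alpha> u \<in> V}"
  define T where "T = Sup S"
  have aS: "a \<in> S" using xV curve by (auto simp: S_def)
  have bdd: "bdd_above S" by (rule bdd_aboveI[of _ b]) (simp add: S_def)
  have "T \<le> b" unfolding T_def by (rule cSup_least) (use aS in \<open>auto simp: S_def\<close>)
  with cSup_upper[OF aS bdd] have T: "a \<le> T" "T \<le> b" by (simp_all add: T_def)
  have below: "\<alpha> u \<in> V" if u: "a \<le> u" "u < T" for u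
  proof -
    obtain t where "t \<in> S" "u < t" using less_cSupE[of u S] u(2) aS unfolding T_def by blast
    then show ?thesis using u(1) by (auto simp: S_def)
  qed
  have "\<alpha> T \<in> V"
  proof (cases "T = a")
    case True
    then show ?thesis using xV curve by simp
  next
    case False
    with T have "a < T" by simp
    define t where "t n = T - (T - a) / real (Suc n)" for n
    have t: "a \<le> t n" "t n < T" for n
    proof -
      have "(T - a) / real (Suc n) \<le> (T - a) / 1"
        using \<open>a < T\<close> by (intro divide_left_mono) auto
      then show "a \<le> t n" by (simp add: t_def)
      show "t n < T" using \<open>a < T\<close> by (simp add: t_def)
    qed
    have t_in: "t n \<in> {a..b}" "t n \<noteq> T" for n using t[of n] T(2) by auto
    have "(\<lambda>n. T - (T - a) * inverse (real (Suc n))) \<longlonglongrightarrow> T - (T - a) * 0"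
      by (intro tendsto_intros LIMSEQ_inverse_real_of_nat)
    then have tlim: "t \<longlonglongrightarrow> T" by (simp add: t_def[abs_def] divide_inverse)
    have "continuous_on {a..b} ?L"
      unfolding curve_length_def by (rule indefinite_integral_continuous_1[OF int])
    then have "(\<lambda>n. ?L (t n)) \<longlonglongrightarrow> ?L T"
      by (rule continuous_on_tendsto_compose[OF _ tlim])
         (use t_in T in auto)
    then have L_Cauchy: "Cauchy (\<lambda>n. ?L (t n))" by (rule LIMSEQ_imp_Cauchy)
    have disp': "m * dist (snd c (\<alpha> s)) (snd c (\<alpha> u)) \<le> \<bar>?L u - ?L s\<bar>"
      if "a \<le> s" "s \<le> u" "u < T" for s u
    proof -
      have "?L s + curve_length A nrm s u \<alpha> = ?L u"
        unfolding curve_length_def using that T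
        by (intro Henstock_Kurzweil_Integration.integral_combine integrable_on_subinterval[OF int]) auto
      moreover have "m * dist (snd c (\<alpha> s)) (snd c (\<alpha> u)) \<le> curve_length A nrm s u \<alpha>"
        using that T by (intro disp below) auto
      ultimately show ?thesis by linarith
    qed
    have disp'': "m * dist (snd c (\<alpha> (t i))) (snd c (\<alpha> (t j))) \<le> dist (?L (t i)) (?L (t j))" for i j
    proof (cases "t i \<le> t j")
      case True
      then show ?thesis using disp'[of "t i" "t j"] t[of i] t[of j] by (simp add: dist_real_def abs_minus_commute)
    next
      case False
      then show ?thesis using disp'[of "t j" "t i"] t[of i] t[of j] by (simp add: dist_real_def dist_commute)
    qed
    have "Cauchy (\<lambda>n. snd c (\<alpha> (t n)))"
    proof (rule metric_CauchyI)
      fix e :: real assume "0 < e"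
      then obtain N where N: "\<And>i j. i \<ge> N \<Longrightarrow> j \<ge> N \<Longrightarrow> dist (?L (t i)) (?L (t j)) < m * e"
        using metric_CauchyD[OF L_Cauchy, of "m * e"] m(1) by auto
      have "dist (snd c (\<alpha> (t i))) (snd c (\<alpha> (t j))) < e" if "i \<ge> N" "j \<ge> N" for i j
        using disp''[of i j] N[OF that] m(1) by (smt (verit) mult_less_cancel_left_pos)
      then show "\<exists>N. \<forall>i\<ge>N. \<forall>j\<ge>N. dist (snd c (\<alpha> (t i))) (snd c (\<alpha> (t j))) < e" by blast
    qed
    then obtain z where z: "(\<lambda>n. snd c (\<alpha> (t n))) \<longlonglongrightarrow> z"
      using Cauchy_convergent convergent_def by blast
    have "m * dist (snd c x) (snd c (\<alpha> (t n))) \<le> ?L b" for n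
    proof -
      have "m * dist (snd c (\<alpha> a)) (snd c (\<alpha> (t n))) \<le> ?L (t n)"
        using t[of n] T by (intro disp below) auto
      also have "\<dots> \<le> ?L b"
        using t[of n] T by (intro curve_length_mono[OF curve(1)]) auto
      finally show ?thesis using curve(3) by simp
    qed
    moreover have "(\<lambda>n. m * dist (snd c x) (snd c (\<alpha> (t n)))) \<longlonglongrightarrow> m * dist (snd c x) z"
      by (intro tendsto_intros z)
    ultimately have "m * dist (snd c x) z \<le> ?L b" by (intro LIMSEQ_le_const2) auto
    with short have "m * dist (snd c x) z < m * r" by simp
    with m(1) have zr: "z \<in> ball (snd c x) r" by simp
    with c(3) obtain y where y: "y \<in> fst c" "snd c y = z" by blast
    have "limitin X (\<lambda>n. \<alpha> (t n)) y sequentially"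
      unfolding limitin_chart[OF c(1) y(1)] using z y t below by (auto simp: V_def)
    moreover have "limitin X (\<lambda>n. \<alpha> (t n)) (\<alpha> T) sequentially"
    proof -
      have "limitin X \<alpha> (\<alpha> T) (at T within {a..b})"
        using T by (intro limitin_continuous_map_within[OF cont]) auto
      moreover have "filterlim t (at T within {a..b}) sequentially"
        unfolding filterlim_at using tlim t_in by simp
      ultimately show ?thesis
        unfolding limitin_def by (auto elim: eventually_compose_filterlim)
    qed
    ultimately have "y = \<alpha> T" by (rule limitin_Hausdorff_unique) (use H in auto)
    then show ?thesis using y zr by (simp add: V_def)
  qed
  then have TV: "\<alpha> u \<in> V" if "a \<le> u" "u \<le> T" for u
    using below that by (cases "u = T") auto
  have "T = b"
  proof (rule ccontr)
    assume "T \<noteq> b"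
    with T have "T < b" by simp
    have "\<forall>\<^sub>F u in at T within {a..b}. \<alpha> u \<in> V"
      using limitin_continuous_map_within[OF cont, of T] V \<open>\<alpha> T \<in> V\<close> T by (auto simp: limitin_def)
    then obtain d where d: "0 < d" "\<And>u. \<lbrakk>u \<in> {a..b}; u \<noteq> T; dist u T < d\<rbrakk> \<Longrightarrow> \<alpha> u \<in> V"
      unfolding eventually_at by blast
    define t where "t = min b (T + d / 2)"
    have t: "T < t" "t \<le> b" "t < T + d" using \<open>T < b\<close> d(1) by (auto simp: t_def)
    have "\<alpha> u \<in> V" if "a \<le> u" "u \<le> t" for u
      using TV[of u] d(2)[of u] that t by (cases "u \<le> T") (auto simp: dist_real_def)
    then have "t \<in> S" using t T by (auto simp: S_def)
    then show False using cSup_upper[OF _ bdd] t(1) unfolding T_def by fastforce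
  qed
  with TV disp[of a b] curve show "\<alpha> b \<in> fst c" "m * dist (snd c x) (snd c (\<alpha> b)) \<le> ?L b"
    by (auto simp: V_def)
qed

lemma adapted_chart_ball:
  assumes c: "c \<in> A" "x \<in> fst c"
  obtains r m M where "0 < r" "0 < m" "0 < M" "ball (snd c x) r \<subseteq> snd c ` fst c"
    "\<And>y v. \<lbrakk>y \<in> fst c; snd c y \<in> ball (snd c x) r\<rbrakk> \<Longrightarrow> m * norm v \<le> nrm (tangent_vector A c y v)"
    "\<And>y v. \<lbrakk>y \<in> fst c; snd c y \<in> ball (snd c x) r\<rbrakk> \<Longrightarrow> nrm (tangent_vector A c y v) \<le> M * norm v"
proof -
  obtain W m M where W: "openin X W" "x \<in> W" "W \<subseteq> fst c" and m: "0 < m" "0 < M"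
    "\<And>y v. y \<in> W \<Longrightarrow> m * norm v \<le> nrm (tangent_vector A c y v)"
    "\<And>y v. y \<in> W \<Longrightarrow> nrm (tangent_vector A c y v) \<le> M * norm v"
    using nrm_locally_equivalent[OF c] by metis
  have "open (snd c ` (W \<inter> fst c))" by (rule open_image_chart[OF W(1) c(1)])
  then obtain r where r: "0 < r" "ball (snd c x) r \<subseteq> snd c ` (W \<inter> fst c)"
    using W c unfolding open_contains_ball by blast
  have "y \<in> W" if "y \<in> fst c" "snd c y \<in> ball (snd c x) r" for y
    using inj_on_image_mem_iff[OF chart_inj[OF c(1)] that(1), of "W \<inter> fst c"] r(2) that(2) by auto
  with r m show ?thesis by (intro that[of r m M]) auto
qed

lemma reach_in_chart_ball:
  assumes "Hausdorff_space X" "reach x y L" "c \<in> A" "x \<in> fst c" "ball (snd c x) r \<subseteq> snd c ` fst c"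
    and "0 < m" "\<And>y v. \<lbrakk>y \<in> fst c; snd c y \<in> ball (snd c x) r\<rbrakk> \<Longrightarrow>
      m * norm v \<le> nrm (tangent_vector A c y v)"
    and "L < m * r"
  shows "y \<in> fst c" "m * dist (snd c x) (snd c y) \<le> L"
proof -
  obtain a b \<alpha> where \<alpha>: "piecewise_C1_curve A a b \<alpha>" "\<alpha> a = x" "\<alpha> b = y"
    "curve_length A nrm a b \<alpha> = L"
    using assms(2) unfolding reach_def by blast
  then have "a \<le> b" by (simp add: piecewise_C1_curve_def)
  note * = short_curve_in_chart_ball[OF assms(1) rectifiable_piecewise[OF \<alpha>(1)] this \<alpha>(2) assms(3-7)]
  show "y \<in> fst c" "m * dist (snd c x) (snd c y) \<le> L"
    using * assms(8) \<alpha> by auto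
qed

lemma reach_connected:
  assumes "connected_space X" "x \<in> points A" "y \<in> points A"
  obtains L where "reach x y L"
proof -
  have nbhd: "\<exists>V. openin X V \<and> z \<in> V \<and> (\<forall>w\<in>V. \<exists>L. reach z w L)" if z: "z \<in> points A" for z
  proof -
    obtain c where c: "c \<in> A" "z \<in> fst c" using z mem_points_iff by blast
    obtain r m M where r: "0 < r" "0 < m" "0 < M" "ball (snd c z) r \<subseteq> snd c ` fst c"
      "\<And>y v. \<lbrakk>y \<in> fst c; snd c y \<in> ball (snd c z) r\<rbrakk> \<Longrightarrow> m * norm v \<le> nrm (tangent_vector A c y v)"
      "\<And>y v. \<lbrakk>y \<in> fst c; snd c y \<in> ball (snd c z) r\<rbrakk> \<Longrightarrow> nrm (tangent_vector A c y v) \<le> M * norm v"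
      by (rule adapted_chart_ball[OF c]) (rule that)
    show ?thesis
    proof (rule exI[of _ "{w \<in> fst c. snd c w \<in> ball (snd c z) r}"], intro conjI ballI)
      show "openin X {w \<in> fst c. snd c w \<in> ball (snd c z) r}"
        by (rule openin_chart_preimage[OF c(1) open_ball])
      show "z \<in> {w \<in> fst c. snd c w \<in> ball (snd c z) r}" using c r(1) by simp
      fix w assume "w \<in> {w \<in> fst c. snd c w \<in> ball (snd c z) r}"
      then have "w \<in> fst c" "snd c w \<in> ball (snd c z) r" by auto
      then show "\<exists>L. reach z w L"
        by (rule reach_segment[OF c _ r(4) _ less_imp_le[OF r(3)] r(6)]) auto
    qed
  qed
  define C where "C = {z \<in> points A. \<exists>L. reach x z L}"
  have "openin X C"
  proof (subst openin_subopen, intro ballI)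
    fix z assume z: "z \<in> C"
    then obtain V where "openin X V" "z \<in> V" "\<forall>w\<in>V. \<exists>L. reach z w L"
      using nbhd[of z] by (auto simp: C_def)
    moreover have "V \<subseteq> C" using z calculation reach_trans reach_points unfolding C_def by blast
    ultimately show "\<exists>T. openin X T \<and> z \<in> T \<and> T \<subseteq> C" by blast
  qed
  moreover have "openin X (points A - C)"
  proof (subst openin_subopen, intro ballI)
    fix z assume z: "z \<in> points A - C"
    then obtain V where "openin X V" "z \<in> V" "\<forall>w\<in>V. \<exists>L. reach z w L"
      using nbhd[of z] by auto
    moreover have "V \<subseteq> points A - C"
      using z calculation reach_trans reach_sym reach_points unfolding C_def by blast
    ultimately show "\<exists>T. openin X T \<and> z \<in> T \<and> T \<subseteq> points A - C" by blast
  qed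
  then have "closedin X C" by (simp add: closedin_def C_def)
  moreover have "x \<in> C" using nbhd[OF assms(2)] assms(2) by (auto simp: C_def)
  ultimately have "C = points A"
    using assms(1) unfolding connected_space_clopen_in by auto
  then show ?thesis using assms(3) that by (auto simp: C_def)
qed

end

locale connected_normed_manifold = normed_manifold A nrm
  for A :: "('m, 'b::banach) chart set" and nrm +
  assumes conn: "connected_space X" and Hausdorff: "Hausdorff_space X"
begin

abbreviation "d \<equiv> path_distance A nrm"

lemma path_distance_eq:
  "x \<in> points A \<Longrightarrow> y \<in> points A \<Longrightarrow> d x y = Inf {L. reach x y L}"
  unfolding path_distance_def reach_def by (simp, rule arg_cong[of _ _ Inf]) blast

lemma path_distance_le:
  assumes "reach x y L"
  shows "d x y \<le> L"
proof -
  have "bdd_below {L. reach x y L}" using reach_nonneg by (intro bdd_belowI[of _ 0]) auto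
  with assms show ?thesis
    by (simp add: path_distance_eq[OF reach_points[OF assms]] cInf_lower)
qed

lemma path_distance_less:
  assumes "x \<in> points A" "y \<in> points A" "d x y < K"
  obtains L where "reach x y L" "L < K"
proof -
  have "{L. reach x y L} \<noteq> {}" using reach_connected[OF conn assms(1,2)] by blast
  from cInf_lessD[OF this] assms show ?thesis using that by (auto simp: path_distance_eq)
qed

lemma path_distance_nonneg: "0 \<le> d x y"
proof (cases "x \<in> points A \<and> y \<in> points A")
  case True
  show ?thesis
  proof (rule ccontr)
    assume "\<not> 0 \<le> d x y"
    then obtain L where "reach x y L" "L < 0" using True path_distance_less[of x y 0] by auto
    then show False using reach_nonneg by fastforce
  qed
qed (auto simp: path_distance_def)

lemma path_distance_commute: "d x y = d y x"
proof (cases "x \<in> points A \<and> y \<in> points A")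
  case True
  have "reach x y = reach y x" using reach_sym by blast
  then show ?thesis using True by (simp add: path_distance_eq)
qed (auto simp: path_distance_def)

lemma path_distance_triangle:
  assumes "x \<in> points A" "y \<in> points A" "z \<in> points A"
  shows "d x z \<le> d x y + d y z"
proof (rule field_le_epsilon)
  fix e :: real assume "0 < e"
  obtain K where K: "reach x y K" "K < d x y + e/2"
    using path_distance_less[OF assms(1,2), of "d x y + e/2"] \<open>0 < e\<close> by auto
  obtain L where L: "reach y z L" "L < d y z + e/2"
    using path_distance_less[OF assms(2,3), of "d y z + e/2"] \<open>0 < e\<close> by auto
  from path_distance_le[OF reach_trans[OF K(1) L(1)]] K(2) L(2)
  show "d x z \<le> d x y + d y z + e" by linarith
qed

lemma path_distance_chart_ball:
  assumes "c \<in> A" "x \<in> fst c"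
  obtains r m M where "0 < r" "0 < m" "0 < M" "ball (snd c x) r \<subseteq> snd c ` fst c"
    "\<And>y. \<lbrakk>y \<in> points A; d x y < m * r\<rbrakk> \<Longrightarrow> y \<in> fst c \<and> m * dist (snd c x) (snd c y) \<le> d x y"
    "\<And>y. \<lbrakk>y \<in> fst c; snd c y \<in> ball (snd c x) r\<rbrakk> \<Longrightarrow> d x y \<le> M * dist (snd c x) (snd c y)"
proof -
  obtain r m M where r: "0 < r" "0 < m" "0 < M" "ball (snd c x) r \<subseteq> snd c ` fst c"
    and m: "\<And>y v. \<lbrakk>y \<in> fst c; snd c y \<in> ball (snd c x) r\<rbrakk> \<Longrightarrow> m * norm v \<le> nrm (tangent_vector A c y v)"
    and M: "\<And>y v. \<lbrakk>y \<in> fst c; snd c y \<in> ball (snd c x) r\<rbrakk> \<Longrightarrow> nrm (tangent_vector A c y v) \<le> M * norm v"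
    by (rule adapted_chart_ball[OF assms]) (rule that)
  have x: "x \<in> points A" using assms mem_points_iff by blast
  show ?thesis
  proof (rule that[OF r])
    fix y assume y: "y \<in> points A" "d x y < m * r"
    have short: "y \<in> fst c \<and> m * dist (snd c x) (snd c y) \<le> L" if "reach x y L" "L < m * r" for L
      using reach_in_chart_ball[OF Hausdorff that(1) assms r(4,2) m that(2)] by blast
    obtain K where K: "reach x y K" "K < m * r" using path_distance_less[OF x y] .
    have "m * dist (snd c x) (snd c y) \<le> d x y"
    proof (rule dense_ge_bounded[OF y(2)])
      fix u assume "d x y < u" "u < m * r"
      then obtain L where "reach x y L" "L < u" using path_distance_less[OF x y(1)] by blast
      with short[of L] \<open>u < m * r\<close> show "m * dist (snd c x) (snd c y) \<le> u" by simp
    qed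
    with short[OF K] show "y \<in> fst c \<and> m * dist (snd c x) (snd c y) \<le> d x y" by blast
  next
    fix y assume "y \<in> fst c" "snd c y \<in> ball (snd c x) r"
    then obtain L where "reach x y L" "L \<le> M * dist (snd c x) (snd c y)"
      using reach_segment[OF assms _ r(4) _ less_imp_le[OF r(3)] M] by blast
    with path_distance_le show "d x y \<le> M * dist (snd c x) (snd c y)" by fastforce
  qed
qed

lemma path_distance_zero_iff:
  assumes "x \<in> points A" "y \<in> points A"
  shows "d x y = 0 \<longleftrightarrow> x = y"
proof -
  obtain c where c: "c \<in> A" "x \<in> fst c" using assms mem_points_iff by blast
  obtain r m M where r: "0 < r" "0 < m" "0 < M" "ball (snd c x) r \<subseteq> snd c ` fst c"
    and m: "\<And>y. \<lbrakk>y \<in> points A; d x y < m * r\<rbrakk> \<Longrightarrow> y \<in> fst c \<and> m * dist (snd c x) (snd c y) \<le> d x y"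
    and M: "\<And>y. \<lbrakk>y \<in> fst c; snd c y \<in> ball (snd c x) r\<rbrakk> \<Longrightarrow> d x y \<le> M * dist (snd c x) (snd c y)"
    by (rule path_distance_chart_ball[OF c]) (rule that)
  have "d x x \<le> 0" using M[of x] c r by simp
  then have "d x x = 0" using path_distance_nonneg[of x x] by linarith
  moreover have "x = y" if "d x y = 0"
  proof -
    have "y \<in> fst c" "m * dist (snd c x) (snd c y) \<le> 0" using m[OF assms(2)] that r by auto
    moreover from this r have "snd c x = snd c y" by (simp add: mult_le_0_iff)
    ultimately show ?thesis using chart_inj[OF c(1)] c(2) by (auto dest: inj_onD)
  qed
  ultimately show ?thesis by auto
qed

sublocale Metric_space "points A" d
  by unfold_locales
    (simp_all add: path_distance_nonneg path_distance_zero_iff path_distance_triangle,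
      rule path_distance_commute)

lemma mtopology_path_distance: "mtopology = X"
proof (unfold topology_eq openin_mtopology, intro allI iffI)
  fix W assume W: "W \<subseteq> points A \<and> (\<forall>x. x \<in> W \<longrightarrow> (\<exists>r>0. mball x r \<subseteq> W))"
  have "open (snd c ` (W \<inter> fst c))" if c: "c \<in> A" for c
    unfolding open_contains_ball
  proof
    fix z assume "z \<in> snd c ` (W \<inter> fst c)"
    then obtain x where x: "x \<in> W" "x \<in> fst c" "z = snd c x" by blast
    obtain \<epsilon> where e: "0 < \<epsilon>" "mball x \<epsilon> \<subseteq> W" using W x(1) by blast
    obtain r m M where r: "0 < r" "0 < m" "0 < M" "ball (snd c x) r \<subseteq> snd c ` fst c"
      and "\<And>y. \<lbrakk>y \<in> points A; d x y < m * r\<rbrakk> \<Longrightarrow> y \<in> fst c \<and> m * dist (snd c x) (snd c y) \<le> d x y"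
      and M: "\<And>y. \<lbrakk>y \<in> fst c; snd c y \<in> ball (snd c x) r\<rbrakk> \<Longrightarrow> d x y \<le> M * dist (snd c x) (snd c y)"
      by (rule path_distance_chart_ball[OF c x(2)]) (rule that)
    have "ball z (min r (\<epsilon> / M)) \<subseteq> snd c ` (W \<inter> fst c)"
    proof
      fix z' assume z': "z' \<in> ball z (min r (\<epsilon> / M))"
      then obtain y where y: "y \<in> fst c" "z' = snd c y" using r(4) x(3) by auto
      have "d x y \<le> M * dist z z'" using M[of y] y z' x(3) by auto
      also have "\<dots> < \<epsilon>" using z' r(3) by (simp add: field_simps)
      finally have "y \<in> mball x \<epsilon>" using x y W c mem_points_iff by auto
      with e y show "z' \<in> snd c ` (W \<inter> fst c)" by blast
    qed
    then show "\<exists>e>0. ball z e \<subseteq> snd c ` (W \<inter> fst c)" using r e by (intro exI[of _ "min r (\<epsilon> / M)"]) auto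
  qed
  then show "openin X W" using W by (auto simp: openin_atlas_topology[OF atlas])
next
  fix W assume W: "openin X W"
  then have sub: "W \<subseteq> points A" using openin_subset by fastforce
  have "\<exists>r>0. mball x r \<subseteq> W" if x: "x \<in> W" for x
  proof -
    obtain c where c: "c \<in> A" "x \<in> fst c" using sub x mem_points_iff by blast
    have "open (snd c ` (W \<inter> fst c))" by (rule open_image_chart[OF W c(1)])
    then obtain s where s: "0 < s" "ball (snd c x) s \<subseteq> snd c ` (W \<inter> fst c)"
      using x c unfolding open_contains_ball by blast
    obtain r m M where r: "0 < r" "0 < m" "0 < M" "ball (snd c x) r \<subseteq> snd c ` fst c"
      and m: "\<And>y. \<lbrakk>y \<in> points A; d x y < m * r\<rbrakk> \<Longrightarrow> y \<in> fst c \<and> m * dist (snd c x) (snd c y) \<le> d x y"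
      and "\<And>y. \<lbrakk>y \<in> fst c; snd c y \<in> ball (snd c x) r\<rbrakk> \<Longrightarrow> d x y \<le> M * dist (snd c x) (snd c y)"
      by (rule path_distance_chart_ball[OF c]) (rule that)
    have "mball x (m * min r s) \<subseteq> W"
    proof
      fix y assume "y \<in> mball x (m * min r s)"
      then have y: "y \<in> points A" "d x y < m * min r s" by auto
      moreover have "m * min r s \<le> m * r" "m * min r s \<le> m * s" using r by auto
      ultimately have "y \<in> fst c" "m * dist (snd c x) (snd c y) < m * s" using m[of y] by auto
      then have "snd c y \<in> snd c ` (W \<inter> fst c)" using s(2) r(2) by auto
      then show "y \<in> W"
        using inj_on_image_mem_iff[OF chart_inj[OF c(1)] \<open>y \<in> fst c\<close>, of "W \<inter> fst c"] by auto
    qed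
    then show ?thesis using r s by (intro exI[of _ "m * min r s"]) auto
  qed
  with sub show "W \<subseteq> points A \<and> (\<forall>x. x \<in> W \<longrightarrow> (\<exists>r>0. mball x r \<subseteq> W))" by blast
qed

end

theorem corollary5p6:
  fixes A :: "('m, 'b::banach) chart set"
    and nrm :: "('m, 'b) tangent \<Rightarrow> real"
  assumes "C1_atlas A"
    and "connected_space (atlas_topology A)"
    and "Hausdorff_space (atlas_topology A)"
    and "continuous_norm A nrm"
  shows "Metric_space (points A) (path_distance A nrm) \<and>
    Metric_space.mtopology (points A) (path_distance A nrm) = atlas_topology A"
proof -
  interpret connected_normed_manifold A nrm
    by unfold_locales (use assms in auto)
  show ?thesis using Metric_space_axioms mtopology_path_distance by blast
qed

end
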